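(* Let $n\geq1$, $\sigma\geq 1$, $s\geq 0$, $\kappa\in[0,1]$, $0\le s_0\le s$, and let $w_0\in H^s\cap L^{1,\kappa}$ (with values in $\mathbb{C}^3$). Let $w$ be the solution of $$w_t-B_0(-\Delta)^{\sigma/2}w-B_1(-\Delta)^{\sigma\alpha}w=0\quad (x\in\mathbb{R}^n,\ t>0),\qquad w(0,x)=w_0(x),$$ and let $S_{\mathrm{int}}$ (for $\alpha\in[1/3,1/2)$) and $\widetilde S_{\mathrm{int}}$ (for $\alpha\in(1/2,1]$) be the profiles built from $w_0$ defined in the context. Then for all $t\ge0$, with implicit constants independent of $t$ and $w_0$: (i) if $\alpha\in[1/3,1/2)$, $$\|(\chi_{\mathrm{int}}(D)w-S_{\mathrm{int}})(t,\cdot)\|_{\dot H^{s_0}}\lesssim (1+t)^{-\frac{n+2(s_0+\kappa)}{2(2\sigma-2\sigma\alpha)}-\frac{1-2\alpha}{2(1-\alpha)}}\|w_0\|_{L^{1,\kappa}}+(1+t)^{-\frac{n+2s_0}{2(2\sigma-2\sigma\alpha)}-\frac{1-2\alpha}{2(1-\alpha)}}|P_{w_0}|;$$ (ii) if $\alpha\in(1/2,1]$, $$\|(\chi_{\mathrm{int}}(D)w-\widetilde S_{\mathrm{int}})(t,\cdot)\|_{\dot H^{s_0}}\lesssim (1+t)^{-\frac{n+2(s_0+\kappa)}{2(6\sigma\alpha-2\sigma)}-\frac{2\alpha-1}{2(3\alpha-1)}}\|w_0\|_{L^{1,\kappa}}+(1+t)^{-\frac{n+2s_0}{2(6\sigm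a\alpha-2\sigma)}-\frac{2\alpha-1}{2(3\alpha-1)}}|P_{w_0}|.$$
   Context: The coefficient matrices are $$B_0=\begin{pmatrix} i&0&0\\0&-i&0\\0&0&0\end{pmatrix},\qquad B_1=\begin{pmatrix}0&0&1\\0&0&1\\-\frac12&-\frac12&-1\end{pmatrix}.$$ $(-\Delta)^{\nu}$ is the Fourier multiplier with symbol $|\xi|^{2\nu}$; solutions are understood through the Fourier transform in $x$, i.e. $\hat w_t=(B_0|\xi|^\sigma+B_1|\xi|^{2\sigma\alpha})\hat w$, $\hat w(0,\xi)=\hat w_0(\xi)$. Spaces: $H^s$, $\dot H^s$ are the Bessel and Riesz potential spaces on $\mathbb{R}^n$ based on $L^2$; $\|f\|_{L^{1,\kappa}}=\int_{\mathbb{R}^n}(1+|x|)^\kappa|f(x)|\,dx$; $P_f=\int_{\mathbb{R}^n}f(x)\,dx$. Cut-off: $\chi_{\mathrm{int}}\in\mathcal{C}^\infty$ is supported in $\{|\xi|\le\varepsilon\}$ with a fixed sufficiently small $\varepsilon\ll1$ (it is part of a smooth partition $\chi_{\mathrm{int}}+\chi_{\mathrm{mid}}+\chi_{\mathrm{ext}}=1$ with $\mathrm{supp}\,\chi_{\mathrm{mid}}\subset\{\varepsilon/2\le|\xi|\le2N\}$, $\mathrm{supp}\,\chi_{\mathrm{ext}}\subset\{|\xi|\ge N\}$, $N\gg1$); $\chi_{\mathrm{int}}(D)$ is the Fourier multiplier with symbol $\chi_{\mathrm{int}}(\xi)$. The matrices $I+N_2$ (if $\alpha<1/2$), respectively $I+N_4$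 and $I+N_5$ (if $\alpha>1/2$), below are invertible on its support. Matrices ($I$ is the $3\times3$ identity): $$N_1=\begin{pmatrix}-1&\frac{i\sqrt3-1}{2}&\frac{-i\sqrt3-1}{2}\\1&\frac{i\sqrt3-1}{2}&\frac{-i\sqrt3-1}{2}\\0&1&1\end{pmatrix},\qquad N_2(|\xi|)=|\xi|^{\sigma-2\sigma\alpha}\begin{pmatrix}0&-\frac{\sqrt3+i}{1+i\sqrt3}&\frac{-\sqrt3+i}{-1+i\sqrt3}\\-\frac{2\sqrt3}{3(1+i\sqrt3)}&0&0\\\frac{2\sqrt3}{3(1-i\sqrt3)}&0&0\end{pmatrix},$$ $$N_4(|\xi|)=|\xi|^{2\sigma\alpha-\sigma}\begin{pmatrix}0&0&i\\0&0&-i\\\frac i2&-\frac i2&0\end{pmatrix},\qquad N_5(|\xi|)=|\xi|^{4\sigma\alpha-2\sigma}\begin{pmatrix}0&\frac14&-1\\\frac14&0&-1\\-\frac12&-\frac12&0\end{pmatrix}.$$ First reference system ($\alpha<1/2$): $\widetilde w$ solves $\widetilde w_t+\widetilde B_0(-\Delta)^{\sigma\alpha}\widetilde w+\widetilde B_1(-\Delta)^{\sigma-\sigma\alpha}\widetilde w=0$ with $\widetilde B_0=\mathrm{diag}(0,\frac12+i\frac{\sqrt3}2,\frac12-i\frac{\sqrt3}2)$, $\widetilde B_1=\mathrm{diag}(1,-\frac12+i\frac{\sqrt3}6,-\frac12-i\frac{\sqrt3}6)$ and initial data whose Fourier transform is $(I+N_2(|\xi|))^{-1}N_1^{-1}\hat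 w_0(\xi)$. Thus its Fourier transform is $\mathrm{diag}(e^{\tilde\lambda_j(|\xi|)t})_{j=1}^3(I+N_2(|\xi|))^{-1}N_1^{-1}\hat w_0(\xi)$, where $\tilde\lambda_1=-|\xi|^{2\sigma-2\sigma\alpha}$, $\tilde\lambda_2=-(\frac12+i\frac{\sqrt3}2)|\xi|^{2\sigma\alpha}+(\frac12-i\frac{\sqrt3}6)|\xi|^{2\sigma-2\sigma\alpha}$, $\tilde\lambda_3=-(\frac12-i\frac{\sqrt3}2)|\xi|^{2\sigma\alpha}+(\frac12+i\frac{\sqrt3}6)|\xi|^{2\sigma-2\sigma\alpha}$. Second reference system ($\alpha>1/2$): $\overline w$ solves $\overline w_t+\overline B_0(-\Delta)^{\sigma/2}\overline w+\overline B_1(-\Delta)^{\sigma\alpha}\overline w+\overline B_2(-\Delta)^{2\sigma\alpha-\sigma/2}\overline w+\overline B_3(-\Delta)^{3\sigma\alpha-\sigma}\overline w=0$ with $\overline B_0=\mathrm{diag}(-i,i,0)$, $\overline B_1=\mathrm{diag}(0,0,1)$, $\overline B_2=\mathrm{diag}(-\frac i2,\frac i2,0)$, $\overline B_3=\mathrm{diag}(\frac12,\frac12,-1)$ and initial data whose Fourier transform is $(I+N_5(|\xi|))^{-1}(I+N_4(|\xi|))^{-1}\hat w_0(\xi)$. Thus its Fourier transform is $\mathrm{diag}(e^{\bar\lambda_j(|\xi|)t})_{j=1}^3(I+N_5(|\xi|))^{-1}(I+N_4(|\xi|))^{-1}\hat w_0(\xi)$, where $\bar\lambda_1=i|\xi|^\sigma+\frac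 i2|\xi|^{4\sigma\alpha-\sigma}-\frac12|\xi|^{6\sigma\alpha-2\sigma}$, $\bar\lambda_2=-i|\xi|^\sigma-\frac i2|\xi|^{4\sigma\alpha-\sigma}-\frac12|\xi|^{6\sigma\alpha-2\sigma}$, $\bar\lambda_3=-|\xi|^{2\sigma\alpha}+|\xi|^{6\sigma\alpha-2\sigma}$. Profiles (defined through their Fourier transforms in $x$): $$\widehat{S_{\mathrm{int}}}(t,\xi)=\chi_{\mathrm{int}}(\xi)N_1(I+N_2(|\xi|))\,\widehat{\widetilde w}(t,\xi)\quad(\alpha<1/2),\qquad \widehat{\widetilde S_{\mathrm{int}}}(t,\xi)=\chi_{\mathrm{int}}(\xi)(I+N_4(|\xi|))(I+N_5(|\xi|))\,\widehat{\overline w}(t,\xi)\quad(\alpha>1/2).$$ *)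

theory Defs
  imports "HOL-Analysis.Analysis"
begin

section \<open>Fourier transform and function spaces\<close>

text \<open>The unitary normalisation is used, so that the inverse transform is an isometry of L2.\<close>

definition fourier :: "(real^'n \<Rightarrow> complex^3) \<Rightarrow> real^'n \<Rightarrow> complex^3" where
  "fourier f \<xi> = (1 / (2 * pi) powr (real CARD('n) / 2)) *\<^sub>R
     (\<integral>x. exp (- (\<i> * complex_of_real (x \<bullet> \<xi>))) *s f x \<partial>lborel)"

definition in_L2 :: "(real^'n \<Rightarrow> complex^3) \<Rightarrow> bool" where
  "in_L2 g \<longleftrightarrow> g \<in> borel_measurable lborel \<and> integrable lborel (\<lambda>\<xi>. (norm (g \<xi>))\<^sup>2)"

definition L2_norm :: "(real^'n \<Rightarrow> complex^3) \<Rightarrow> real" where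
  "L2_norm g = sqrt (\<integral>\<xi>. (norm (g \<xi>))\<^sup>2 \<partial>lborel)"

text \<open>The part of the Bessel potential space of order \<open>s\<close> that consists of integrable functions, whose
  Fourier transform is the integral above.\<close>

definition sobolev_L1 :: "real \<Rightarrow> (real^'n \<Rightarrow> complex^3) set" where
  "sobolev_L1 s = {f. integrable lborel f \<and>
     in_L2 (\<lambda>\<xi>. (1 + (norm \<xi>)\<^sup>2) powr (s / 2) *\<^sub>R fourier f \<xi>)}"

definition weighted_L1 :: "real \<Rightarrow> (real^'n \<Rightarrow> complex^3) set" where
  "weighted_L1 \<kappa> = {f. integrable lborel (\<lambda>x. (1 + norm x) powr \<kappa> *\<^sub>R f x)}"

definition weighted_L1_norm :: "real \<Rightarrow> (real^'n \<Rightarrow> complex^3) \<Rightarrow> real" where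
  "weighted_L1_norm \<kappa> f = (\<integral>x. (1 + norm x) powr \<kappa> * norm (f x) \<partial>lborel)"

definition mean :: "(real^'n \<Rightarrow> complex^3) \<Rightarrow> complex^3" where
  "mean f = (\<integral>x. f x \<partial>lborel)"

text \<open>The solutions and profiles below are functions of \<open>x\<close> given by their Fourier transforms in \<open>x\<close>.
  Accordingly, membership in the homogeneous (Riesz potential) space of order \<open>s\<close> and the norm there
  are functionals of the Fourier transform \<open>g\<close>. The norm is the real number intended only for members
  (a Bochner integral that does not exist is 0). For \<open>s = 0\<close> the weight is 1 except at the origin,
  a null set.\<close>

definition in_Hdot_hat :: "real \<Rightarrow> (real^'n \<Rightarrow> complex^3) \<Rightarrow> bool" where
  "in_Hdot_hat s g \<longleftrightarrow> in_L2 (\<lambda>\<xi>. norm \<xi> powr s *\<^sub>R g \<xi>)"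

definition Hdot_norm_hat :: "real \<Rightarrow> (real^'n \<Rightarrow> complex^3) \<Rightarrow> real" where
  "Hdot_norm_hat s g = L2_norm (\<lambda>\<xi>. norm \<xi> powr s *\<^sub>R g \<xi>)"

section \<open>Cut-off functions\<close>

primrec C_diff :: "nat \<Rightarrow> (real^'n \<Rightarrow> real) \<Rightarrow> bool" where
  "C_diff 0 f \<longleftrightarrow> continuous_on UNIV f"
| "C_diff (Suc k) f \<longleftrightarrow> (\<forall>x. f differentiable (at x)) \<and>
     (\<forall>v. C_diff k (\<lambda>x. frechet_derivative f (at x) v))"

definition smooth :: "(real^'n \<Rightarrow> real) \<Rightarrow> bool" where
  "smooth f \<longleftrightarrow> (\<forall>k. C_diff k f)"

definition fn_support :: "(real^'n \<Rightarrow> real) \<Rightarrow> (real^'n) set" where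
  "fn_support f = closure {\<xi>. f \<xi> \<noteq> 0}"

definition frequency_partition ::
  "real \<Rightarrow> real \<Rightarrow> (real^'n \<Rightarrow> real) \<Rightarrow> (real^'n \<Rightarrow> real) \<Rightarrow> (real^'n \<Rightarrow> real) \<Rightarrow> bool" where
  "frequency_partition \<epsilon> N \<chi>int \<chi>mid \<chi>ext \<longleftrightarrow>
     smooth \<chi>int \<and> smooth \<chi>mid \<and> smooth \<chi>ext \<and>
     fn_support \<chi>int \<subseteq> {\<xi>. norm \<xi> \<le> \<epsilon>} \<and>
     fn_support \<chi>mid \<subseteq> {\<xi>. \<epsilon> / 2 \<le> norm \<xi> \<and> norm \<xi> \<le> 2 * N} \<and>
     fn_support \<chi>ext \<subseteq> {\<xi>. N \<le> norm \<xi>} \<and>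
     (\<forall>\<xi>. \<chi>int \<xi> + \<chi>mid \<xi> + \<chi>ext \<xi> = 1)"

section \<open>The matrices\<close>

abbreviation rt3 :: complex where
  "rt3 \<equiv> complex_of_real (sqrt 3)"

definition mat3 :: "complex list list \<Rightarrow> complex^3^3" where
  "mat3 rs = vector (map vector rs)"

definition diag3 :: "complex \<Rightarrow> complex \<Rightarrow> complex \<Rightarrow> complex^3^3" where
  "diag3 a b c = mat3 [[a, 0, 0], [0, b, 0], [0, 0, c]]"

definition B0 :: "complex^3^3" where
  "B0 = diag3 \<i> (- \<i>) 0"

definition B1 :: "complex^3^3" where
  "B1 = mat3 [[0, 0, 1], [0, 0, 1], [- 1/2, - 1/2, - 1]]"

definition N1 :: "complex^3^3" where
  "N1 = mat3 [[- 1, (\<i> * rt3 - 1) / 2, (- \<i> * rt3 - 1) / 2],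
              [1, (\<i> * rt3 - 1) / 2, (- \<i> * rt3 - 1) / 2],
              [0, 1, 1]]"

text \<open>In \<open>N2\<close>, \<open>N4\<close> and \<open>N5\<close> the last argument is the radial frequency.\<close>

definition N2 :: "real \<Rightarrow> real \<Rightarrow> real \<Rightarrow> complex^3^3" where
  "N2 \<sigma> \<alpha> r = r powr (\<sigma> - 2 * \<sigma> * \<alpha>) *\<^sub>R
     mat3 [[0, - ((rt3 + \<i>) / (1 + \<i> * rt3)), (- rt3 + \<i>) / (- 1 + \<i> * rt3)],
           [- (2 * rt3 / (3 * (1 + \<i> * rt3))), 0, 0],
           [2 * rt3 / (3 * (1 - \<i> * rt3)), 0, 0]]"

definition N4 :: "real \<Rightarrow> real \<Rightarrow> real \<Rightarrow> complex^3^3" where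
  "N4 \<sigma> \<alpha> r = r powr (2 * \<sigma> * \<alpha> - \<sigma>) *\<^sub>R
     mat3 [[0, 0, \<i>], [0, 0, - \<i>], [\<i> / 2, - \<i> / 2, 0]]"

definition N5 :: "real \<Rightarrow> real \<Rightarrow> real \<Rightarrow> complex^3^3" where
  "N5 \<sigma> \<alpha> r = r powr (4 * \<sigma> * \<alpha> - 2 * \<sigma>) *\<^sub>R
     mat3 [[0, 1/4, - 1], [1/4, 0, - 1], [- 1/2, - 1/2, 0]]"

section \<open>Evolution systems, understood through the Fourier transform in x\<close>

definition frac_lap_symbol :: "real \<Rightarrow> real^'n \<Rightarrow> real" where
  "frac_lap_symbol \<nu> \<xi> = norm \<xi> powr (2 * \<nu>)"

text \<open>\<open>W t \<xi>\<close> is the Fourier transform in \<open>x\<close> of the solution at time \<open>t\<close>; for every frequency it solves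
  the linear ordinary differential equation with matrix \<open>A \<xi>\<close> and initial value \<open>g \<xi>\<close>.\<close>

definition fourier_solution ::
  "(real^'n \<Rightarrow> complex^3^3) \<Rightarrow> (real^'n \<Rightarrow> complex^3) \<Rightarrow> (real \<Rightarrow> real^'n \<Rightarrow> complex^3) \<Rightarrow> bool" where
  "fourier_solution A g W \<longleftrightarrow>
     (\<forall>\<xi>. W 0 \<xi> = g \<xi> \<and>
        (\<forall>t\<ge>0. ((\<lambda>\<tau>. W \<tau> \<xi>) has_vector_derivative A \<xi> *v W t \<xi>) (at t within {0..})))"

definition main_solution ::
  "real \<Rightarrow> real \<Rightarrow> (real^'n \<Rightarrow> complex^3) \<Rightarrow> (real \<Rightarrow> real^'n \<Rightarrow> complex^3) \<Rightarrow> bool" where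
  "main_solution \<sigma> \<alpha> w0 =
     fourier_solution
       (\<lambda>\<xi>. frac_lap_symbol (\<sigma> / 2) \<xi> *\<^sub>R B0 + frac_lap_symbol (\<sigma> * \<alpha>) \<xi> *\<^sub>R B1)
       (fourier w0)"

definition first_reference ::
  "real \<Rightarrow> real \<Rightarrow> (real^'n \<Rightarrow> complex^3) \<Rightarrow> (real \<Rightarrow> real^'n \<Rightarrow> complex^3) \<Rightarrow> bool" where
  "first_reference \<sigma> \<alpha> w0 =
     fourier_solution
       (\<lambda>\<xi>. - (frac_lap_symbol (\<sigma> * \<alpha>) \<xi> *\<^sub>R
                  diag3 0 (1/2 + \<i> * rt3 / 2) (1/2 - \<i> * rt3 / 2)
              + frac_lap_symbol (\<sigma> - \<sigma> * \<alpha>) \<xi> *\<^sub>R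
                  diag3 1 (- 1/2 + \<i> * rt3 / 6) (- 1/2 - \<i> * rt3 / 6)))
       (\<lambda>\<xi>. matrix_inv (mat 1 + N2 \<sigma> \<alpha> (norm \<xi>)) *v (matrix_inv N1 *v fourier w0 \<xi>))"

definition second_reference ::
  "real \<Rightarrow> real \<Rightarrow> (real^'n \<Rightarrow> complex^3) \<Rightarrow> (real \<Rightarrow> real^'n \<Rightarrow> complex^3) \<Rightarrow> bool" where
  "second_reference \<sigma> \<alpha> w0 =
     fourier_solution
       (\<lambda>\<xi>. - (frac_lap_symbol (\<sigma> / 2) \<xi> *\<^sub>R diag3 (- \<i>) \<i> 0
              + frac_lap_symbol (\<sigma> * \<alpha>) \<xi> *\<^sub>R diag3 0 0 1
              + frac_lap_symbol (2 * \<sigma> * \<alpha> - \<sigma> / 2) \<xi> *\<^sub>R diag3 (- \<i> / 2) (\<i> / 2) 0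
              + frac_lap_symbol (3 * \<sigma> * \<alpha> - \<sigma>) \<xi> *\<^sub>R diag3 (1/2) (1/2) (- 1)))
       (\<lambda>\<xi>. matrix_inv (mat 1 + N5 \<sigma> \<alpha> (norm \<xi>)) *v
             (matrix_inv (mat 1 + N4 \<sigma> \<alpha> (norm \<xi>)) *v fourier w0 \<xi>))"

section \<open>Fourier transforms of the profiles\<close>

definition S_int_hat ::
  "real \<Rightarrow> real \<Rightarrow> (real^'n \<Rightarrow> real) \<Rightarrow> (real \<Rightarrow> real^'n \<Rightarrow> complex^3) \<Rightarrow> real \<Rightarrow> real^'n \<Rightarrow> complex^3" where
  "S_int_hat \<sigma> \<alpha> \<chi>int W t \<xi> =
     \<chi>int \<xi> *\<^sub>R ((N1 ** (mat 1 + N2 \<sigma> \<alpha> (norm \<xi>))) *v W t \<xi>)"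

definition S_int_tilde_hat ::
  "real \<Rightarrow> real \<Rightarrow> (real^'n \<Rightarrow> real) \<Rightarrow> (real \<Rightarrow> real^'n \<Rightarrow> complex^3) \<Rightarrow> real \<Rightarrow> real^'n \<Rightarrow> complex^3" where
  "S_int_tilde_hat \<sigma> \<alpha> \<chi>int W t \<xi> =
     \<chi>int \<xi> *\<^sub>R (((mat 1 + N4 \<sigma> \<alpha> (norm \<xi>)) ** (mat 1 + N5 \<sigma> \<alpha> (norm \<xi>))) *v W t \<xi>)"

end

theory Submission
  imports Defs "HOL-Real_Asymp.Real_Asymp"
begin

text \<open>At a frequency of size \<open>r\<close> the system is an ordinary differential equation whose matrix is, up to a
  positive factor \<open>a\<close>, a perturbation \<open>A0 + \<delta> A1\<close> of a fixed matrix, where \<open>\<delta>\<close> is the quotient of the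
  two powers of \<open>r\<close>.  For \<open>\<alpha> < 1/2\<close> the damping dominates: \<open>a = r powr (2 \<sigma> \<alpha>)\<close>,
  \<open>\<delta> = r powr (\<sigma> - 2 \<sigma> \<alpha>)\<close> and the matrix is \<open>B1 + \<delta> B0\<close>.  For \<open>\<alpha> > 1/2\<close> the
  oscillation dominates: \<open>a = r powr \<sigma>\<close>, \<open>\<delta> = r powr (2 \<sigma> \<alpha> - \<sigma>)\<close> and the matrix is
  \<open>B0 + \<delta> B1\<close>.  The reference systems are diagonal, and their entries are the expansions of the
  eigenvalues of this matrix.  The slowest mode decays at the rate \<open>a \<delta>\<^sup>p\<close>, with \<open>p = 2\<close> in the
  first regime and \<open>p = 3\<close> in the second.

  The reference matrix \<open>D\<close> and the transformation \<open>T\<close> of the profile do not satisfy \<open>A T = T D\<close> up to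
  order \<open>\<delta>\<^bsup>p+1\<^esup>\<close>: the diagonal of \<open>D\<close> is right, but an off-diagonal error of order
  \<open>\<delta>\<^sup>p\<close>, as large as the decay rate, survives.  One further factor \<open>I + N\<close> with
  \<open>N\<close> of order \<open>\<delta>\<^sup>p\<close> removes it.  The remaining error is \<open>\<delta>\<close> times the decay rate, so the
  energy method compares the flow of the system with the diagonal flow, and dropping \<open>I + N\<close> again
  costs only \<open>O(\<delta>)\<close>.  This gives the pointwise estimate, in lemmas
  \<open>first_profile_error\<close> and \<open>second_profile_error\<close>:
  the difference of solution and profile is at most
  \<open>K \<delta> exp (- a \<delta>\<^sup>p t / 8)\<close> times the size of the initial datum at this frequency.

  Here \<open>\<delta>\<close> and \<open>a \<delta>\<^sup>p\<close> are powers \<open>r powr k\<close> and \<open>r powr m\<close> of the frequency.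
  The Fourier transform of the datum is at most a constant times
  \<open>r powr \<kappa>\<close> times its weighted norm plus its mean, because a character differs from 1 by at most
  \<open>2 \<bar>x \<bullet> \<xi>\<bar> powr \<kappa>\<close>.  The claim is then the decay of
  \<open>\<integral> \<bar>\<xi>\<bar> powr p exp (- c \<bar>\<xi>\<bar> powr m t)\<close> over the unit ball at the rate
  \<open>- (n + p) / m\<close> (lemma \<open>low_frequency_integral_decay\<close>), and the factor \<open>r powr k\<close> improves the rate
  of the norm by \<open>k / m\<close>.  Solutions are only known to satisfy a
  differential equation at every frequency, so their measurability in \<open>\<xi>\<close> is proved as well: they are
  limits of Taylor polynomials.\<close>

section \<open>Linear systems that are almost diagonal\<close>

text \<open>Half of the dissipation absorbs the force by Young's inequality.  The norm then decays at half of the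
  available rate, but the bound is free of the factor \<open>t\<close> that Duhamel's formula produces when force and
  flow decay equally fast.\<close>

lemma dissipative_energy_decay:
  fixes u f :: "real \<Rightarrow> 'a::real_inner"
  assumes c: "c > 0"
    and deriv: "\<And>t. t \<ge> 0 \<Longrightarrow> (u has_vector_derivative L (u t) + f t) (at t within {0..})"
    and diss: "\<And>x. L x \<bullet> x \<le> - c * (norm x)\<^sup>2"
    and force: "\<And>t. t \<ge> 0 \<Longrightarrow> norm (f t) \<le> F * exp (- c * t)"
    and t: "t \<ge> 0"
  shows "(norm (u t))\<^sup>2 \<le> exp (- c * t) * ((norm (u 0))\<^sup>2 + (F / c)\<^sup>2)"
proof (cases "t = 0")
  case True
  then show ?thesis by simp
next
  case False
  \<comment> \<open>The second summand is the part of the bound that the force has not used up at time \<open>s\<close>.\<close>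
  define \<phi> where "\<phi> s = exp (c * s) * (u s \<bullet> u s) + (F / c)\<^sup>2 * exp (- c * s)" for s
  have cont: "continuous_on {0..t} u"
  proof -
    have "continuous_on {0..} u"
      using deriv by (intro continuous_on_vector_derivative) auto
    then show ?thesis by (rule continuous_on_subset) auto
  qed
  have "\<phi> t \<le> \<phi> 0"
  proof (rule DERIV_nonpos_imp_decreasing_open[where f = \<phi>])
    show "continuous_on {0..t} \<phi>"
      unfolding \<phi>_def using cont by (intro continuous_intros)
    fix s assume s: "0 < s" "s < t"
    define g where "g = L (u s) + f s"
    have "(u has_vector_derivative g) (at s)"
      using deriv[of s] s at_within_interior[of s "{0..}"] by (simp add: g_def)
    then have du: "(u has_derivative (\<lambda>h. h *\<^sub>R g)) (at s)"
      by (simp add: has_vector_derivative_def)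
    have "((\<lambda>s. u s \<bullet> u s) has_derivative (\<lambda>h. u s \<bullet> (h *\<^sub>R g) + (h *\<^sub>R g) \<bullet> u s)) (at s)"
      by (rule has_derivative_inner[OF du du])
    then have duu: "((\<lambda>s. u s \<bullet> u s) has_real_derivative 2 * (g \<bullet> u s)) (at s)"
      unfolding has_field_derivative_def
      by (rule has_derivative_eq_rhs) (auto simp: fun_eq_iff inner_commute algebra_simps)
    have d: "(\<phi> has_real_derivative
        (exp (c * s) * c * (u s \<bullet> u s) + exp (c * s) * (2 * (g \<bullet> u s)) + (F / c)\<^sup>2 * (exp (- c * s) * (- c)))) (at s)"
      unfolding \<phi>_def by (auto intro!: derivative_eq_intros duu)
    have "2 * (norm (f s) * norm (u s)) \<le> (norm (f s))\<^sup>2 / c + c * (norm (u s))\<^sup>2"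
    proof -
      have "0 \<le> (norm (f s) - c * norm (u s))\<^sup>2 / c" using c by simp
      also have "\<dots> = (norm (f s))\<^sup>2 / c + c * (norm (u s))\<^sup>2 - 2 * (norm (f s) * norm (u s))"
        using c by (simp add: power2_eq_square field_simps)
      finally show ?thesis by simp
    qed
    moreover have "f s \<bullet> u s \<le> norm (f s) * norm (u s)" by (rule norm_cauchy_schwarz)
    moreover have "L (u s) \<bullet> u s \<le> - c * (norm (u s))\<^sup>2" by (rule diss)
    ultimately have "c * (u s \<bullet> u s) + 2 * (g \<bullet> u s) \<le> (norm (f s))\<^sup>2 / c"
      by (simp add: g_def inner_add_left power2_norm_eq_inner)
    also have "\<dots> \<le> (F * exp (- c * s))\<^sup>2 / c"
      using force[of s] s c by (intro divide_right_mono power_mono) auto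
    finally have "exp (c * s) * (c * (u s \<bullet> u s) + 2 * (g \<bullet> u s)) \<le> exp (c * s) * ((F * exp (- c * s))\<^sup>2 / c)"
      by (intro mult_left_mono) auto
    also have "\<dots> = (F / c)\<^sup>2 * (exp (- c * s) * c)"
      using c by (simp add: power2_eq_square exp_minus field_simps)
    finally have "exp (c * s) * c * (u s \<bullet> u s) + exp (c * s) * (2 * (g \<bullet> u s)) + (F / c)\<^sup>2 * (exp (- c * s) * (- c)) \<le> 0"
      by (simp add: algebra_simps)
    with d show "\<exists>y. (\<phi> has_real_derivative y) (at s) \<and> y \<le> 0" by blast
  qed (use t in auto)
  moreover have "exp (c * t) * (u t \<bullet> u t) \<le> \<phi> t" by (simp add: \<phi>_def)
  moreover have "\<phi> 0 = (norm (u 0))\<^sup>2 + (F / c)\<^sup>2" by (simp add: \<phi>_def power2_norm_eq_inner)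
  ultimately have "exp (c * t) * (u t \<bullet> u t) \<le> (norm (u 0))\<^sup>2 + (F / c)\<^sup>2" by linarith
  then have "exp (- c * t) * (exp (c * t) * (u t \<bullet> u t)) \<le> exp (- c * t) * ((norm (u 0))\<^sup>2 + (F / c)\<^sup>2)"
    by (intro mult_left_mono) auto
  then show ?thesis
    by (simp add: mult.assoc[symmetric] exp_add[symmetric] power2_norm_eq_inner)
qed

lemma invertible_if_bounded_below:
  fixes A :: "complex^3^3"
  assumes "\<And>x. norm x \<le> K * norm (A *v x)"
  shows "invertible A"
proof -
  have "x = 0" if "A *v x = 0" for x
    using assms[of x] that by simp
  then obtain B where "B ** A = mat 1"
    by (metis matrix_left_invertible_ker)
  then show ?thesis by (auto simp: invertible_left_inverse)
qed

lemma small_perturbation_of_identity: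
  fixes N :: "complex^3^3"
  assumes N: "\<And>x. norm (N *v x) \<le> q * norm x" and q: "q \<le> 1 / 2"
  shows "norm ((mat 1 + N) *v x) \<le> 2 * norm x" "norm x \<le> 2 * norm ((mat 1 + N) *v x)"
proof -
  have e: "(mat 1 + N) *v x = x + N *v x" by (simp add: matrix_vector_mult_add_rdistrib)
  have "q * norm x \<le> 1 / 2 * norm x" using q by (intro mult_right_mono) auto
  then have n: "norm (N *v x) \<le> norm x / 2" using N[of x] by linarith
  show "norm ((mat 1 + N) *v x) \<le> 2 * norm x"
    unfolding e using n norm_triangle_ineq[of x "N *v x"] norm_ge_zero[of x] by linarith
  show "norm x \<le> 2 * norm ((mat 1 + N) *v x)"
    unfolding e using n norm_diff_ineq[of x "N *v x"] by linarith
qed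

lemma matrix_inv_mult_vec:
  fixes A :: "complex^3^3"
  assumes "invertible A"
  shows "A *v (matrix_inv A *v x) = x" "matrix_inv A *v (A *v x) = x"
proof -
  have "A ** matrix_inv A = mat 1 \<and> matrix_inv A ** A = mat 1"
    using assms unfolding invertible_def matrix_inv_def by (rule someI_ex)
  then show "A *v (matrix_inv A *v x) = x" "matrix_inv A *v (A *v x) = x"
    by (simp_all add: matrix_vector_mul_assoc)
qed

lemma has_vector_derivative_matrix_mult:
  fixes A :: "complex^3^3"
  assumes "(u has_vector_derivative u') F"
  shows "((\<lambda>t. A *v u t) has_vector_derivative A *v u') F"
  using bounded_linear.has_vector_derivative[OF matrix_vector_mul_bounded_linear assms] .

text \<open>In the coordinates \<open>U = T (1 + N)\<close> the matrix \<open>M\<close> is \<open>D + R\<close>, where \<open>R\<close> is small compared with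
  the decay rate \<open>c\<close>.  There the difference of both flows solves a dissipative equation with force
  \<open>R v\<close>, and its initial value is of the size of \<open>N\<close>.  The correction \<open>N\<close> enters only the residual: the
  flow is compared with \<open>T v\<close>.\<close>

lemma almost_diagonal_flow:
  fixes M T N D :: "complex^3^3" and w v :: "real \<Rightarrow> complex^3"
  assumes c: "c > 0" and K: "K \<ge> 1" and q: "0 \<le> q" "2 * K * q \<le> 1"
    and T: "\<And>x. norm (T *v x) \<le> K * norm x" "\<And>x. norm x \<le> K * norm (T *v x)"
    and N: "\<And>x. norm (N *v x) \<le> q * norm x"
    and D: "\<And>x. (D *v x) \<bullet> x \<le> - (2 * c) * (norm x)\<^sup>2"
    and res: "\<And>x. norm ((M ** (T ** (mat 1 + N)) - T ** (mat 1 + N) ** D) *v x) \<le> q * c / 2 * norm x"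
    and w: "\<And>t. t \<ge> 0 \<Longrightarrow> (w has_vector_derivative M *v w t) (at t within {0..})"
    and v: "\<And>t. t \<ge> 0 \<Longrightarrow> (v has_vector_derivative D *v v t) (at t within {0..})"
    and init: "T *v v 0 = w 0" and t: "t \<ge> 0"
  shows "norm (w t - T *v v t) \<le> 9 * K ^ 3 * q * exp (- (c / 2) * t) * norm (w 0)"
proof -
  have "2 * 1 * q \<le> 2 * K * q" using K q by (intro mult_mono) auto
  then have q2: "q \<le> 1 / 2" using q by linarith
  define U where "U = T ** (mat 1 + N)"
  define R where "R = matrix_inv U ** (M ** U - U ** D)"
  note N' = small_perturbation_of_identity[OF N q2]
  have U_vec: "U *v x = T *v (x + N *v x)" for x
    by (simp add: U_def matrix_vector_mul_assoc[symmetric] matrix_vector_mult_add_rdistrib)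
  have U_le: "norm (U *v x) \<le> 2 * K * norm x" for x
  proof -
    have "norm (U *v x) \<le> K * norm ((mat 1 + N) *v x)"
      unfolding U_def matrix_vector_mul_assoc[symmetric] by (rule T)
    also have "\<dots> \<le> K * (2 * norm x)" using K by (intro mult_left_mono N') auto
    finally show ?thesis by simp
  qed
  have U_ge: "norm x \<le> 2 * K * norm (U *v x)" for x
  proof -
    have "norm x \<le> 2 * norm ((mat 1 + N) *v x)" by (rule N')
    also have "\<dots> \<le> 2 * (K * norm (U *v x))"
      unfolding U_def matrix_vector_mul_assoc[symmetric] by (intro mult_left_mono T) auto
    finally show ?thesis by simp
  qed
  have "invertible U" by (rule invertible_if_bounded_below[OF U_ge])
  note U_inv = matrix_inv_mult_vec[OF this]
  have MU: "M *v (U *v x) = U *v (D *v x + R *v x)" for x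
    by (simp add: R_def matrix_vector_mul_assoc[symmetric] matrix_vector_right_distrib U_inv
        matrix_vector_mult_diff_rdistrib)
  have R: "norm (R *v x) \<le> K * q * c * norm x" for x
  proof -
    have "norm (R *v x) \<le> 2 * K * norm (U *v (R *v x))" by (rule U_ge)
    also have "U *v (R *v x) = (M ** U - U ** D) *v x"
      by (simp add: R_def matrix_vector_mul_assoc[symmetric] U_inv)
    also have "2 * K * norm ((M ** U - U ** D) *v x) \<le> 2 * K * (q * c / 2 * norm x)"
      using res[of x] K unfolding U_def by (intro mult_left_mono) auto
    finally show ?thesis by (simp add: mult_ac)
  qed
  define F where "F = K * q * c * norm (v 0)"
  have v_le: "norm (v s) \<le> exp (- c * s) * norm (v 0)" if "s \<ge> 0" for s
  proof -
    have "(norm (v s))\<^sup>2 \<le> exp (- (2 * c) * s) * ((norm (v 0))\<^sup>2 + (0 / (2 * c))\<^sup>2)"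
      by (rule dissipative_energy_decay[where L = "\<lambda>x. D *v x" and f = "\<lambda>_. 0"])
        (use c v D that in auto)
    also have "\<dots> = (exp (- c * s) * norm (v 0))\<^sup>2"
      by (simp add: power_mult_distrib exp_double[symmetric] mult.assoc)
    finally show ?thesis by (rule power2_le_imp_le) auto
  qed
  \<comment> \<open>The difference of both flows in the coordinates \<open>U\<close>.\<close>
  define u where "u t = matrix_inv U *v w t - v t" for t
  have w_u: "w s = U *v (u s + v s)" for s
    by (simp add: u_def U_inv)
  have u_deriv: "(u has_vector_derivative (D + R) *v u s + R *v v s) (at s within {0..})" if "s \<ge> 0" for s
  proof -
    have "(u has_vector_derivative matrix_inv U *v (M *v w s) - D *v v s) (at s within {0..})"
      unfolding u_def by (intro has_vector_derivative_diff has_vector_derivative_matrix_mult w v that)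
    moreover have "matrix_inv U *v (M *v w s) - D *v v s = (D + R) *v u s + R *v v s"
      unfolding w_u MU U_inv
      by (simp add: matrix_vector_right_distrib matrix_vector_mult_add_rdistrib)
    ultimately show ?thesis by simp
  qed
  have "(norm (u t))\<^sup>2 \<le> exp (- c * t) * ((norm (u 0))\<^sup>2 + (F / c)\<^sup>2)"
  proof (rule dissipative_energy_decay[OF c u_deriv])
    fix x :: "complex^3"
    have "(R *v x) \<bullet> x \<le> norm (R *v x) * norm x" by (rule norm_cauchy_schwarz)
    also have "\<dots> \<le> K * q * c * norm x * norm x" by (intro mult_right_mono R) auto
    also have "\<dots> = (K * q) * (c * (norm x)\<^sup>2)" by (simp add: power2_eq_square)
    also have "\<dots> \<le> 1 * (c * (norm x)\<^sup>2)" using q(2) c by (intro mult_right_mono) auto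
    finally show "((D + R) *v x) \<bullet> x \<le> - c * (norm x)\<^sup>2"
      using D[of x] by (simp add: matrix_vector_mult_add_rdistrib inner_add_left)
  next
    fix s :: real assume "s \<ge> 0"
    have "norm (R *v v s) \<le> K * q * c * (exp (- c * s) * norm (v 0))"
      using R[of "v s"] v_le[OF \<open>s \<ge> 0\<close>] K q c
      by (elim order_trans) (intro mult_left_mono, auto)
    then show "norm (R *v v s) \<le> F * exp (- c * s)" by (simp add: F_def mult_ac)
  qed (use t in auto)
  also have "\<dots> \<le> exp (- c * t) * (norm (u 0) + F / c)\<^sup>2"
  proof -
    have "0 \<le> 2 * norm (u 0) * (F / c)" using K q c by (simp add: F_def)
    then show ?thesis by (intro mult_left_mono) (auto simp: power2_sum)
  qed
  also have "\<dots> = (exp (- (c / 2) * t) * (norm (u 0) + F / c))\<^sup>2"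
    by (simp add: power_mult_distrib exp_double[symmetric])
  finally have u1: "norm (u t) \<le> exp (- (c / 2) * t) * (norm (u 0) + F / c)"
    by (rule power2_le_imp_le) (use K q c in \<open>auto simp: F_def\<close>)
  have u0: "norm (u 0) \<le> 2 * q * norm (v 0)"
  proof -
    have "(mat 1 + N) *v u 0 = - (N *v v 0)"
    proof -
      have "T *v ((mat 1 + N) *v (u 0 + v 0)) = T *v v 0"
        using w_u[of 0] init by (simp add: U_def matrix_vector_mul_assoc)
      moreover have "x = y" if "T *v x = T *v y" for x y
        using T(2)[of "x - y"] that by (simp add: matrix_vector_mult_diff_distrib)
      ultimately have "(mat 1 + N) *v (u 0 + v 0) = v 0" by blast
      then show ?thesis
        by (simp add: matrix_vector_right_distrib matrix_vector_mult_add_rdistrib algebra_simps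
            eq_neg_iff_add_eq_0)
    qed
    then have "norm (u 0) \<le> 2 * norm (N *v v 0)" using N'(2)[of "u 0"] by simp
    then show ?thesis using N[of "v 0"] by simp
  qed
  have "F / c = K * q * norm (v 0)" using c by (simp add: F_def)
  moreover have "q * norm (v 0) \<le> K * (q * norm (v 0))"
    using mult_right_mono[OF K, of "q * norm (v 0)"] q by simp
  ultimately have "norm (u 0) + F / c \<le> 3 * (K * (q * norm (v 0)))" using u0 by (simp add: mult_ac)
  then have "norm (u t) \<le> exp (- (c / 2) * t) * (3 * (K * (q * norm (v 0))))"
    using u1 by (elim order_trans) (intro mult_left_mono, auto)
  then have "norm (U *v u t) \<le> 2 * K * (exp (- (c / 2) * t) * (3 * (K * (q * norm (v 0)))))"
    using U_le[of "u t"] K by (elim order_trans) (intro mult_left_mono, auto)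
  moreover have "norm (T *v (N *v v t)) \<le> K * (q * (exp (- (c / 2) * t) * norm (v 0)))"
  proof -
    have e: "exp (- c * t) \<le> exp (- (c / 2) * t)" using c t by simp
    have "norm (v t) \<le> exp (- (c / 2) * t) * norm (v 0)"
      using v_le[OF t] mult_right_mono[OF e norm_ge_zero[of "v 0"]] by linarith
    then have "q * norm (v t) \<le> q * (exp (- (c / 2) * t) * norm (v 0))" using q by (intro mult_left_mono) auto
    then have "norm (N *v v t) \<le> q * (exp (- (c / 2) * t) * norm (v 0))" using N[of "v t"] by linarith
    then have "K * norm (N *v v t) \<le> K * (q * (exp (- (c / 2) * t) * norm (v 0)))" using K by (intro mult_left_mono) auto
    then show ?thesis using T(1)[of "N *v v t"] by linarith
  qed
  moreover have "w t - T *v v t = U *v u t + T *v (N *v v t)"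
    by (simp add: w_u[of t] U_vec matrix_vector_right_distrib)
  ultimately have "norm (w t - T *v v t) \<le> (6 * K\<^sup>2 + K) * (q * exp (- (c / 2) * t) * norm (v 0))"
    using norm_triangle_ineq[of "U *v u t" "T *v (N *v v t)"] by (simp add: algebra_simps power2_eq_square)
  also have "\<dots> \<le> (9 * K\<^sup>2) * (q * exp (- (c / 2) * t) * (K * norm (w 0)))"
    using K q T(2)[of "v 0"] self_le_power[of K 2] unfolding init
    by (intro mult_mono) auto
  finally show ?thesis by (simp add: power2_eq_square power3_eq_cube mult_ac)
qed

lemmas mat3_entries = mat3_def diag3_def vec_eq_iff forall_3 sum_3 matrix_matrix_mult_def

lemma diag3_plus: "diag3 a b c + diag3 a' b' c' = diag3 (a + a') (b + b') (c + c')"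
  by (simp add: mat3_entries)

lemma diag3_scale: "k *\<^sub>R diag3 a b c = diag3 (k *\<^sub>R a) (k *\<^sub>R b) (k *\<^sub>R c)"
  by (simp add: mat3_entries)

lemma diag3_dissipative:
  assumes "Re a \<le> - \<gamma>" "Re b \<le> - \<gamma>" "Re c \<le> - \<gamma>"
  shows "(diag3 a b c *v x) \<bullet> x \<le> - \<gamma> * (norm x)\<^sup>2"
proof -
  have i: "(z * y) \<bullet> y = Re z * (norm y)\<^sup>2" for z y :: complex
    unfolding inner_complex_def cmod_power2 by (simp add: power2_eq_square algebra_simps)
  have "(diag3 a b c *v x) \<bullet> x = Re a * (norm (x $ 1))\<^sup>2 + Re b * (norm (x $ 2))\<^sup>2 + Re c * (norm (x $ 3))\<^sup>2"
    by (simp add: inner_vec_def matrix_vector_mult_def sum_3 diag3_def mat3_def i)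
  also have "\<dots> \<le> - \<gamma> * (norm (x $ 1))\<^sup>2 + - \<gamma> * (norm (x $ 2))\<^sup>2 + - \<gamma> * (norm (x $ 3))\<^sup>2"
    using assms by (intro add_mono mult_right_mono) auto
  also have "\<dots> = - \<gamma> * (norm x)\<^sup>2"
    by (simp add: norm_vec_def L2_set_def sum_3 algebra_simps)
  finally show ?thesis .
qed

lemma matrix_mult_scale_left: "(k *\<^sub>R A) ** B = k *\<^sub>R (A ** B)" for A B :: "complex^3^3"
  by (simp add: scalar_matrix_assoc)

lemma matrix_mult_scale_right: "A ** (k *\<^sub>R B) = k *\<^sub>R (A ** B)" for A B :: "complex^3^3"
  by (simp add: matrix_matrix_mult_def vec_eq_iff scaleR_sum_right)

lemma matrix_mult_add_left: "(A + B) ** C = A ** C + B ** C" for A B C :: "complex^3^3"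
  by (simp add: matrix_matrix_mult_def vec_eq_iff distrib_right sum.distrib)

lemma scale_matrix_vector: "(k *\<^sub>R A) *v x = k *\<^sub>R (A *v x)" for A :: "complex^3^3"
  by (simp add: matrix_vector_mult_def vec_eq_iff scaleR_sum_right)

lemmas matrix_expand = matrix_mult_scale_left matrix_mult_scale_right matrix_mult_add_left
  matrix_add_ldistrib matrix_mul_assoc

lemma continuous_on_matrix_mult [continuous_intros]:
  fixes A B :: "'a::topological_space \<Rightarrow> complex^3^3"
  assumes "continuous_on S A" "continuous_on S B"
  shows "continuous_on S (\<lambda>x. A x ** B x)"
  unfolding matrix_matrix_mult_def by (intro continuous_intros assms)

text \<open>The remainders below are matrix polynomials in \<open>\<delta>\<close>; compactness bounds them uniformly without
  estimating their entries.\<close>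

lemma continuous_matrix_family_bounded:
  fixes Q :: "real \<Rightarrow> complex^3^3"
  assumes Q: "continuous_on {0..1} Q"
  obtains K where "K \<ge> 1" "\<And>\<delta> x. 0 \<le> \<delta> \<Longrightarrow> \<delta> \<le> 1 \<Longrightarrow> norm (Q \<delta> *v x) \<le> K * norm x"
proof -
  have "continuous_on ({0..1} \<times> sphere 0 1) (\<lambda>p. Q (fst p) *v snd p)"
    unfolding matrix_vector_mult_def
    by (intro continuous_intros continuous_on_compose2[OF Q]) auto
  then have "bounded ((\<lambda>p. Q (fst p) *v snd p) ` ({0..1} \<times> sphere 0 1))"
    by (intro compact_imp_bounded compact_continuous_image compact_Times) auto
  then obtain B where B: "\<And>\<delta> y. \<delta> \<in> {0..1} \<Longrightarrow> y \<in> sphere 0 1 \<Longrightarrow> norm (Q \<delta> *v y) \<le> B"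
    unfolding bounded_iff by fastforce
  show ?thesis
  proof
    show "max B 1 \<ge> 1" by simp
    fix \<delta> :: real and x :: "complex^3" assume \<delta>: "0 \<le> \<delta>" "\<delta> \<le> 1"
    show "norm (Q \<delta> *v x) \<le> max B 1 * norm x"
    proof (cases "x = 0")
      case False
      have "Q \<delta> *v x = norm x *\<^sub>R (Q \<delta> *v (x /\<^sub>R norm x))"
        using False by (simp add: linear_scale[OF bounded_linear.linear[OF matrix_vector_mul_bounded_linear]])
      then have "norm (Q \<delta> *v x) = norm x * norm (Q \<delta> *v (x /\<^sub>R norm x))" by simp
      also have "\<dots> \<le> norm x * max B 1"
        using B[of \<delta> "x /\<^sub>R norm x"] \<delta> False by (intro mult_left_mono) (auto simp: max_def)
      finally show ?thesis by (simp add: mult.commute)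
    qed simp
  qed
qed

lemma matrix_bounded:
  fixes A :: "complex^3^3"
  obtains K where "K \<ge> 1" "\<And>x. norm (A *v x) \<le> K * norm x"
  using continuous_matrix_family_bounded[of "\<lambda>_. A"] by (metis continuous_on_const order_refl zero_le_one)

lemma invertible_bounded_below:
  fixes A :: "complex^3^3"
  assumes "invertible A"
  obtains K where "K \<ge> 1" "\<And>x. norm x \<le> K * norm (A *v x)"
proof -
  obtain K where "K \<ge> 1" "\<And>x. norm (matrix_inv A *v x) \<le> K * norm x"
    using matrix_bounded by blast
  then show ?thesis using that matrix_inv_mult_vec(2)[OF assms] by metis
qed

text \<open>If \<open>U0 + \<delta> U1 + \<delta>\<^sup>2 U2\<close> diagonalises \<open>A0 + \<delta> A1\<close> as a formal power series up to second order,
  the three coefficient equations hold and the defect is divisible by \<open>\<delta>\<^sup>3\<close>, with a polynomial cofactor.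
  The first-order part of the eigenvalues is zero here.\<close>

lemma residual_third_order:
  fixes A0 A1 U0 U1 U2 V L0 L2 :: "complex^3^3" and \<delta> :: real
  assumes "A0 ** U0 = U0 ** L0"
    and "A0 ** U1 + A1 ** U0 = U1 ** L0"
    and "A0 ** U2 + A1 ** U1 = U2 ** L0 + U0 ** L2"
  shows "(A0 + \<delta> *\<^sub>R A1) ** (U0 + \<delta> *\<^sub>R U1 + \<delta>\<^sup>2 *\<^sub>R U2 + \<delta> ^ 3 *\<^sub>R V)
      - (U0 + \<delta> *\<^sub>R U1 + \<delta>\<^sup>2 *\<^sub>R U2 + \<delta> ^ 3 *\<^sub>R V) ** (L0 + \<delta>\<^sup>2 *\<^sub>R L2)
    = \<delta> ^ 3 *\<^sub>R ((A0 + \<delta> *\<^sub>R A1) ** V - V ** (L0 + \<delta>\<^sup>2 *\<^sub>R L2) + A1 ** U2 - U1 ** L2 + (- \<delta>) *\<^sub>R (U2 ** L2))"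
proof -
  have e: "A1 ** U0 = U1 ** L0 - A0 ** U1" "A1 ** U1 = U2 ** L0 + U0 ** L2 - A0 ** U2"
    using assms by (auto simp: algebra_simps)
  show ?thesis
    by (simp add: matrix_expand assms(1) e scaleR_add_right scaleR_diff_right power2_eq_square power3_eq_cube
        algebra_simps)
qed

text \<open>The same expansion carried one order further.  The matrix \<open>V\<close> may itself depend on \<open>\<delta>\<close>, so it collects
  all terms of the transformation of order four and higher.\<close>

lemma residual_fourth_order:
  fixes A0 A1 U0 U1 U2 U3 V L0 L1 L2 L3 :: "complex^3^3" and \<delta> :: real
  assumes "A0 ** U0 = U0 ** L0"
    and "A0 ** U1 + A1 ** U0 = U1 ** L0 + U0 ** L1"
    and "A0 ** U2 + A1 ** U1 = U2 ** L0 + U1 ** L1 + U0 ** L2"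
    and "A0 ** U3 + A1 ** U2 = U3 ** L0 + U2 ** L1 + U1 ** L2 + U0 ** L3"
  shows "(A0 + \<delta> *\<^sub>R A1) ** (U0 + \<delta> *\<^sub>R U1 + \<delta>\<^sup>2 *\<^sub>R U2 + \<delta> ^ 3 *\<^sub>R U3 + \<delta> ^ 4 *\<^sub>R V)
      - (U0 + \<delta> *\<^sub>R U1 + \<delta>\<^sup>2 *\<^sub>R U2 + \<delta> ^ 3 *\<^sub>R U3 + \<delta> ^ 4 *\<^sub>R V) ** (L0 + \<delta> *\<^sub>R L1 + \<delta>\<^sup>2 *\<^sub>R L2 + \<delta> ^ 3 *\<^sub>R L3)
    = \<delta> ^ 4 *\<^sub>R ((A0 + \<delta> *\<^sub>R A1) ** V - V ** (L0 + \<delta> *\<^sub>R L1 + \<delta>\<^sup>2 *\<^sub>R L2 + \<delta> ^ 3 *\<^sub>R L3)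
        + A1 ** U3 - U3 ** (L1 + \<delta> *\<^sub>R L2 + \<delta>\<^sup>2 *\<^sub>R L3) - U2 ** (L2 + \<delta> *\<^sub>R L3) - U1 ** L3)"
proof -
  have e: "A1 ** U0 = U1 ** L0 + U0 ** L1 - A0 ** U1"
    "A1 ** U1 = U2 ** L0 + U1 ** L1 + U0 ** L2 - A0 ** U2"
    "A1 ** U2 = U3 ** L0 + U2 ** L1 + U1 ** L2 + U0 ** L3 - A0 ** U3"
    using assms by (auto simp: algebra_simps)
  show ?thesis
    by (simp add: matrix_expand assms(1) e scaleR_add_right scaleR_diff_right power2_eq_square power3_eq_cube
        power4_eq_xxxx algebra_simps)
qed


text \<open>The quantitative form of the method for a system with matrix \<open>a A(\<delta>)\<close>: dissipation of order
  \<open>\<delta>\<^sup>p\<close> and a defect of order \<open>\<delta>\<^bsup>p+1\<^esup>\<close> give a relative error of order \<open>\<delta>\<close>.  All constants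
  are uniform in \<open>a\<close>, which scales time.\<close>

lemma profile_error_of_diagonalisation:
  fixes A D T N :: "real \<Rightarrow> complex^3^3" and p :: nat
  assumes d0: "d0 > 0" and K1: "K1 \<ge> 1" and K2: "K2 \<ge> 1" and K3: "K3 \<ge> 0"
    and T: "\<And>\<delta> x. 0 < \<delta> \<Longrightarrow> \<delta> \<le> d0 \<Longrightarrow> norm (T \<delta> *v x) \<le> K1 * norm x"
      "\<And>\<delta> x. 0 < \<delta> \<Longrightarrow> \<delta> \<le> d0 \<Longrightarrow> norm x \<le> K1 * norm (T \<delta> *v x)"
    and N: "\<And>\<delta> x. 0 < \<delta> \<Longrightarrow> \<delta> \<le> d0 \<Longrightarrow> norm (N \<delta> *v x) \<le> K2 * \<delta> * norm x"
    and res: "\<And>\<delta> x. 0 < \<delta> \<Longrightarrow> \<delta> \<le> d0 \<Longrightarrow>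
      norm ((A \<delta> ** (T \<delta> ** (mat 1 + N \<delta>)) - (T \<delta> ** (mat 1 + N \<delta>)) ** D \<delta>) *v x) \<le> K3 * \<delta> ^ Suc p * norm x"
    and D: "\<And>\<delta> x. 0 < \<delta> \<Longrightarrow> \<delta> \<le> d0 \<Longrightarrow> (D \<delta> *v x) \<bullet> x \<le> - (\<delta> ^ p / 2) * (norm x)\<^sup>2"
  obtains q0 K where "0 < q0" "q0 \<le> d0" "K > 0"
    "\<And>a \<delta> w v t. 0 < a \<Longrightarrow> 0 < \<delta> \<Longrightarrow> \<delta> \<le> q0 \<Longrightarrow>
      (\<And>t. t \<ge> 0 \<Longrightarrow> (w has_vector_derivative (a *\<^sub>R A \<delta>) *v w t) (at t within {0..})) \<Longrightarrow>
      (\<And>t. t \<ge> 0 \<Longrightarrow> (v has_vector_derivative (a *\<^sub>R D \<delta>) *v v t) (at t within {0..})) \<Longrightarrow>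
      T \<delta> *v v 0 = w 0 \<Longrightarrow> t \<ge> 0 \<Longrightarrow>
      norm (w t - T \<delta> *v v t) \<le> K * \<delta> * exp (- (a * \<delta> ^ p / 8) * t) * norm (w 0)"
proof -
  \<comment> \<open>Large enough for \<open>N\<close>, and for the residual relative to \<open>c = a \<delta>\<^sup>p / 4\<close>, half of the dissipation.\<close>
  define L where "L = K2 + 8 * K3"
  have L: "L \<ge> 1" using K2 K3 by (simp add: L_def)
  define q0 where "q0 = min d0 (1 / (2 * K1 * L))"
  show ?thesis
  proof
    show "0 < q0" "q0 \<le> d0" using d0 K1 L by (auto simp: q0_def)
    show "9 * K1 ^ 3 * L > 0" using K1 L by simp
    fix a \<delta> t :: real and w v :: "real \<Rightarrow> complex^3"
    assume a: "0 < a" and \<delta>: "0 < \<delta>" "\<delta> \<le> q0"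
      and w: "\<And>t. t \<ge> 0 \<Longrightarrow> (w has_vector_derivative (a *\<^sub>R A \<delta>) *v w t) (at t within {0..})"
      and v: "\<And>t. t \<ge> 0 \<Longrightarrow> (v has_vector_derivative (a *\<^sub>R D \<delta>) *v v t) (at t within {0..})"
      and init: "T \<delta> *v v 0 = w 0" and t: "t \<ge> 0"
    have \<delta>d: "\<delta> \<le> d0" using \<delta> by (simp add: q0_def)
    have "2 * K1 * L * \<delta> \<le> 2 * K1 * L * (1 / (2 * K1 * L))"
      using \<delta> K1 L by (intro mult_left_mono) (auto simp: q0_def)
    then have q1: "2 * K1 * (L * \<delta>) \<le> 1" using K1 L by simp
    have "norm (w t - T \<delta> *v v t) \<le> 9 * K1 ^ 3 * (L * \<delta>) * exp (- ((a * \<delta> ^ p / 4) / 2) * t) * norm (w 0)"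
    proof (rule almost_diagonal_flow[where M = "a *\<^sub>R A \<delta>" and D = "a *\<^sub>R D \<delta>" and N = "N \<delta>"])
      show "norm (N \<delta> *v x) \<le> L * \<delta> * norm x" for x
        by (rule order_trans[OF N[OF \<delta>(1) \<delta>d]]) (use K3 \<delta> in \<open>auto intro!: mult_right_mono simp: L_def\<close>)
      show "((a *\<^sub>R D \<delta>) *v x) \<bullet> x \<le> - (2 * (a * \<delta> ^ p / 4)) * (norm x)\<^sup>2" for x
        using mult_left_mono[OF D[OF \<delta>(1) \<delta>d, of x], of a] a
        by (simp add: scale_matrix_vector algebra_simps)
      show "norm ((a *\<^sub>R A \<delta> ** (T \<delta> ** (mat 1 + N \<delta>)) - T \<delta> ** (mat 1 + N \<delta>) ** (a *\<^sub>R D \<delta>)) *v x)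
          \<le> L * \<delta> * (a * \<delta> ^ p / 4) / 2 * norm x" for x
      proof -
        have "a *\<^sub>R A \<delta> ** (T \<delta> ** (mat 1 + N \<delta>)) - T \<delta> ** (mat 1 + N \<delta>) ** (a *\<^sub>R D \<delta>)
            = a *\<^sub>R (A \<delta> ** (T \<delta> ** (mat 1 + N \<delta>)) - T \<delta> ** (mat 1 + N \<delta>) ** D \<delta>)"
          by (simp add: matrix_mult_scale_left matrix_mult_scale_right scaleR_diff_right)
        then have "norm ((a *\<^sub>R A \<delta> ** (T \<delta> ** (mat 1 + N \<delta>)) - T \<delta> ** (mat 1 + N \<delta>) ** (a *\<^sub>R D \<delta>)) *v x)
            \<le> a * (K3 * \<delta> ^ Suc p * norm x)"
          using res[OF \<delta>(1) \<delta>d, of x] a by (simp add: scale_matrix_vector)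
        also have "\<dots> = 8 * K3 * (a * \<delta> ^ Suc p / 8 * norm x)" by simp
        also have "\<dots> \<le> L * (a * \<delta> ^ Suc p / 8 * norm x)"
          using K2 a \<delta> by (intro mult_right_mono) (auto simp: L_def)
        finally show ?thesis by (simp add: algebra_simps)
      qed
    qed (use a \<delta> \<delta>d K1 L q1 T w v init t in auto)
    then show "norm (w t - T \<delta> *v v t) \<le> 9 * K1 ^ 3 * L * \<delta> * exp (- (a * \<delta> ^ p / 8) * t) * norm (w 0)"
      by (simp add: mult.assoc)
  qed
qed

lemma scaled_matrix_norm_le:
  fixes A :: "complex^3^3"
  assumes "\<And>x. norm (A *v x) \<le> K * norm x" "0 \<le> s" "s \<le> q"  "K \<ge> 0"
  shows "norm ((s *\<^sub>R A) *v x) \<le> K * q * norm x"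
proof -
  have "norm ((s *\<^sub>R A) *v x) \<le> s * (K * norm x)"
    using assms by (simp add: scale_matrix_vector mult_left_mono)
  also have "\<dots> \<le> q * (K * norm x)" using assms by (intro mult_right_mono) auto
  finally show ?thesis by (simp add: mult_ac)
qed

lemma mat1_mult: "mat 1 ** A = A" "A ** mat 1 = A" for A :: "complex^3^3"
  by simp_all

section \<open>The symbol at low frequencies\<close>

text \<open>The coefficient matrix of \<open>N2\<close> with its denominators cleared.\<close>

definition N2_coeff :: "complex^3^3" where
  "N2_coeff = mat3 [[0, (- rt3 + \<i>) / 2, (rt3 + \<i>) / 2], [- rt3 / 6 + \<i> / 2, 0, 0], [rt3 / 6 + \<i> / 2, 0, 0]]"

text \<open>Solves the second-order equation of the first regime, the third of \<open>first_identities\<close>: its entries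
  are, up to sign, the off-diagonal entries of the second-order defect divided by the differences of the eigenvalues of
  \<open>B1\<close>.  Only the two damped modes are coupled at this order.\<close>

definition N3_coeff :: "complex^3^3" where
  "N3_coeff = mat3 [[0, 0, 0], [0, 0, - 1 / 6 + \<i> * rt3 / 6], [0, - 1 / 6 - \<i> * rt3 / 6, 0]]"

definition N4_coeff :: "complex^3^3" where
  "N4_coeff = mat3 [[0, 0, \<i>], [0, 0, - \<i>], [\<i> / 2, - \<i> / 2, 0]]"

definition N5_coeff :: "complex^3^3" where
  "N5_coeff = mat3 [[0, 1/4, - 1], [1/4, 0, - 1], [- 1/2, - 1/2, 0]]"

text \<open>Solves the third-order equation of the second regime, the last of \<open>second_identities\<close>: its entries
  are, up to sign, the off-diagonal entries of the third-order defect divided by the differences of the eigenvalues of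
  \<open>B0\<close>.\<close>

definition N6_coeff :: "complex^3^3" where
  "N6_coeff = mat3 [[0, \<i> / 4, - \<i>], [- \<i> / 4, 0, \<i>], [- \<i> / 2, \<i> / 2, 0]]"

lemma rt3_sq: "rt3 * rt3 = 3" "rt3 * (rt3 * z) = 3 * z"
  by (simp_all flip: of_real_mult mult.assoc)

lemma N2_eq: "N2 \<sigma> \<alpha> r = r powr (\<sigma> - 2 * \<sigma> * \<alpha>) *\<^sub>R N2_coeff"
proof -
  have nz: "1 + \<i> * rt3 \<noteq> 0" "- 1 + \<i> * rt3 \<noteq> 0" "1 - \<i> * rt3 \<noteq> 0"
    "3 + \<i> * (3 * rt3) \<noteq> 0" "3 - \<i> * (3 * rt3) \<noteq> 0"
    by (auto simp: complex_eq_iff)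
  have "- ((rt3 + \<i>) / (1 + \<i> * rt3)) = (- rt3 + \<i>) / 2"
    using nz by (simp add: divide_simps) (simp add: algebra_simps rt3_sq)
  moreover have "(- rt3 + \<i>) / (- 1 + \<i> * rt3) = (rt3 + \<i>) / 2"
    using nz by (simp add: divide_simps) (simp add: algebra_simps rt3_sq)
  moreover have "- (2 * rt3 / (3 * (1 + \<i> * rt3))) = - rt3 / 6 + \<i> / 2"
    using nz by (simp add: divide_simps) (simp add: algebra_simps rt3_sq)
  moreover have "2 * rt3 / (3 * (1 - \<i> * rt3)) = rt3 / 6 + \<i> / 2"
    using nz by (simp add: divide_simps) (simp add: algebra_simps rt3_sq)
  ultimately show ?thesis unfolding N2_def N2_coeff_def by (simp only:)
qed

lemma N4_eq: "N4 \<sigma> \<alpha> r = r powr (2 * \<sigma> * \<alpha> - \<sigma>) *\<^sub>R N4_coeff"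
  by (simp add: N4_def N4_coeff_def)

lemma N5_eq: "N5 \<sigma> \<alpha> r = (r powr (2 * \<sigma> * \<alpha> - \<sigma>))\<^sup>2 *\<^sub>R N5_coeff"
  by (simp add: N5_def N5_coeff_def power2_eq_square powr_add[symmetric] algebra_simps)

abbreviation "first_diag0 \<equiv> diag3 0 (- (1/2 + \<i> * rt3 / 2)) (- (1/2 - \<i> * rt3 / 2))"
abbreviation "first_diag2 \<equiv> diag3 (- 1) (1/2 - \<i> * rt3 / 6) (1/2 + \<i> * rt3 / 6)"

abbreviation "second_diag1 \<equiv> diag3 0 0 (- 1)"
abbreviation "second_diag2 \<equiv> diag3 (\<i> / 2) (- \<i> / 2) 0"
abbreviation "second_diag3 \<equiv> diag3 (- 1/2) (- 1/2) 1"

text \<open>The first three coefficients of the eigenvalue equation.  In the second one the eigenvalues get no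
  correction; the second diagonal matrix in the third one is their second-order part.\<close>

lemma first_identities:
  "B1 ** N1 = N1 ** first_diag0"
  "B1 ** (N1 ** N2_coeff) + B0 ** N1 = (N1 ** N2_coeff) ** first_diag0"
  "B1 ** (N1 ** N3_coeff) + B0 ** (N1 ** N2_coeff) = (N1 ** N3_coeff) ** first_diag0 + N1 ** first_diag2"
  by (simp_all add: mat3_entries B0_def B1_def N1_def N2_coeff_def N3_coeff_def) (auto simp: field_simps rt3_sq)

text \<open>The coefficients of orders one to three of the eigenvalue equation; the diagonal matrices on the right
  are the corrections of the eigenvalues in the second reference system.\<close>

lemma second_identities:
  "B0 ** N4_coeff + B1 = N4_coeff ** B0 + second_diag1"
  "B0 ** N5_coeff + B1 ** N4_coeff = N5_coeff ** B0 + N4_coeff ** second_diag1 + second_diag2"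
  "B0 ** (N4_coeff ** N5_coeff + N6_coeff) + B1 ** N5_coeff
     = (N4_coeff ** N5_coeff + N6_coeff) ** B0 + N5_coeff ** second_diag1
       + N4_coeff ** second_diag2 + second_diag3"
  by (simp_all add: mat3_entries B0_def B1_def N4_coeff_def N5_coeff_def N6_coeff_def)

lemma N1_invertible: "invertible N1"
proof -
  have "det N1 = - 2 * \<i> * rt3"
    by (simp add: det_3 N1_def mat3_def field_simps)
  then show ?thesis by (simp add: invertible_det_nz)
qed

text \<open>The slowest mode is the eigenvalue near zero of \<open>B1\<close>, which the oscillation moves to
  \<open>- \<delta>\<^sup>2\<close>; the other two are damped at rate \<open>1/2\<close>.\<close>

lemma first_profile_error:
  obtains q0 K where "0 < q0" "q0 \<le> 1" "K > 0"
    "\<And>\<delta>. 0 < \<delta> \<Longrightarrow> \<delta> \<le> q0 \<Longrightarrow> invertible (mat 1 + \<delta> *\<^sub>R N2_coeff)"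
    "\<And>a \<delta> w v t. 0 < a \<Longrightarrow> 0 < \<delta> \<Longrightarrow> \<delta> \<le> q0 \<Longrightarrow>
      (\<And>t. t \<ge> 0 \<Longrightarrow> (w has_vector_derivative (a *\<^sub>R (B1 + \<delta> *\<^sub>R B0)) *v w t) (at t within {0..})) \<Longrightarrow>
      (\<And>t. t \<ge> 0 \<Longrightarrow> (v has_vector_derivative (a *\<^sub>R (first_diag0 + \<delta>\<^sup>2 *\<^sub>R first_diag2)) *v v t) (at t within {0..})) \<Longrightarrow>
      (N1 ** (mat 1 + \<delta> *\<^sub>R N2_coeff)) *v v 0 = w 0 \<Longrightarrow> t \<ge> 0 \<Longrightarrow>
      norm (w t - (N1 ** (mat 1 + \<delta> *\<^sub>R N2_coeff)) *v v t) \<le> K * \<delta> * exp (- (a * \<delta>\<^sup>2 / 8) * t) * norm (w 0)"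
proof -
  obtain k1 where k1: "k1 \<ge> 1" "\<And>x. norm (N1 *v x) \<le> k1 * norm x" using matrix_bounded by blast
  obtain k1' where k1': "k1' \<ge> 1" "\<And>x. norm x \<le> k1' * norm (N1 *v x)"
    using invertible_bounded_below[OF N1_invertible] by blast
  obtain k2 where k2: "k2 \<ge> 1" "\<And>x. norm (N2_coeff *v x) \<le> k2 * norm x" using matrix_bounded by blast
  obtain k3 where k3: "k3 \<ge> 1" "\<And>x. norm (N3_coeff *v x) \<le> k3 * norm x" using matrix_bounded by blast
  define d0 where "d0 = 1 / (2 * k2)"
  have d0: "d0 > 0" "d0 \<le> 1 / 2" using k2 by (auto simp: d0_def field_simps)
  have small: "k2 * \<delta> \<le> 1 / 2" if "\<delta> \<le> d0" for \<delta>
    using mult_left_mono[OF that, of k2] k2 by (simp add: d0_def)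
  have N2s: "norm ((\<delta> *\<^sub>R N2_coeff) *v x) \<le> k2 * \<delta> * norm x" if "0 < \<delta>" for \<delta> x
    using scaled_matrix_norm_le[OF k2(2), of \<delta> \<delta>] that k2 by simp
  note IN2 = small_perturbation_of_identity[OF N2s small]
  define Q where "Q \<delta> = (B1 + \<delta> *\<^sub>R B0) ** (N1 ** N2_coeff ** N3_coeff)
      - (N1 ** N2_coeff ** N3_coeff) ** (first_diag0 + \<delta>\<^sup>2 *\<^sub>R first_diag2)
      + B0 ** (N1 ** N3_coeff) - (N1 ** N2_coeff) ** first_diag2 + (- \<delta>) *\<^sub>R ((N1 ** N3_coeff) ** first_diag2)" for \<delta>
  have "continuous_on {0..1} Q" unfolding Q_def by (intro continuous_intros)
  then obtain kQ where kQ: "kQ \<ge> 1" "\<And>\<delta> x. 0 \<le> \<delta> \<Longrightarrow> \<delta> \<le> 1 \<Longrightarrow> norm (Q \<delta> *v x) \<le> kQ * norm x"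
    using continuous_matrix_family_bounded by blast
  have U: "N1 ** (mat 1 + \<delta> *\<^sub>R N2_coeff) ** (mat 1 + \<delta>\<^sup>2 *\<^sub>R N3_coeff)
      = N1 + \<delta> *\<^sub>R (N1 ** N2_coeff) + \<delta>\<^sup>2 *\<^sub>R (N1 ** N3_coeff) + \<delta> ^ 3 *\<^sub>R (N1 ** N2_coeff ** N3_coeff)" for \<delta>
    by (simp add: matrix_expand scaleR_add_right power3_eq_cube power2_eq_square algebra_simps)
  obtain q0 K where q: "0 < q0" "q0 \<le> d0" "K > 0"
    and est: "\<And>a \<delta> w v t. 0 < a \<Longrightarrow> 0 < \<delta> \<Longrightarrow> \<delta> \<le> q0 \<Longrightarrow>
      (\<And>t. t \<ge> 0 \<Longrightarrow> (w has_vector_derivative (a *\<^sub>R (B1 + \<delta> *\<^sub>R B0)) *v w t) (at t within {0..})) \<Longrightarrow>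
      (\<And>t. t \<ge> 0 \<Longrightarrow> (v has_vector_derivative (a *\<^sub>R (first_diag0 + \<delta>\<^sup>2 *\<^sub>R first_diag2)) *v v t) (at t within {0..})) \<Longrightarrow>
      (N1 ** (mat 1 + \<delta> *\<^sub>R N2_coeff)) *v v 0 = w 0 \<Longrightarrow> t \<ge> 0 \<Longrightarrow>
      norm (w t - (N1 ** (mat 1 + \<delta> *\<^sub>R N2_coeff)) *v v t) \<le> K * \<delta> * exp (- (a * \<delta>\<^sup>2 / 8) * t) * norm (w 0)"
  proof (rule profile_error_of_diagonalisation[where p = 2 and ?d0.0 = d0 and ?K1.0 = "2 * k1 * k1'" and ?K2.0 = k3
        and ?K3.0 = kQ and N = "\<lambda>\<delta>. \<delta>\<^sup>2 *\<^sub>R N3_coeff" and T = "\<lambda>\<delta>. N1 ** (mat 1 + \<delta> *\<^sub>R N2_coeff)"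
        and A = "\<lambda>\<delta>. B1 + \<delta> *\<^sub>R B0" and D = "\<lambda>\<delta>. first_diag0 + \<delta>\<^sup>2 *\<^sub>R first_diag2"])
    show "2 * k1 * k1' \<ge> 1" using k1 k1' mult_mono[of 1 k1 1 k1'] by simp
    fix \<delta> :: real and x :: "complex^3" assume \<delta>: "0 < \<delta>" "\<delta> \<le> d0"
    have "norm (N1 *v ((mat 1 + \<delta> *\<^sub>R N2_coeff) *v x)) \<le> k1 * (2 * norm x)"
      using k1 IN2(1)[OF \<delta>, of x] by (meson mult_left_mono order_trans zero_le_one)
    also have "\<dots> \<le> k1 * (2 * norm x) * k1'" using mult_left_mono[OF k1'(1), of "k1 * (2 * norm x)"] k1 by simp
    finally show "norm ((N1 ** (mat 1 + \<delta> *\<^sub>R N2_coeff)) *v x) \<le> 2 * k1 * k1' * norm x"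
      by (simp add: matrix_vector_mul_assoc mult_ac)
    have "norm x \<le> 2 * norm ((mat 1 + \<delta> *\<^sub>R N2_coeff) *v x)" by (rule IN2(2)[OF \<delta>])
    also have "\<dots> \<le> 2 * (k1' * norm (N1 *v ((mat 1 + \<delta> *\<^sub>R N2_coeff) *v x)))" using k1' by simp
    also have "\<dots> \<le> k1 * (2 * (k1' * norm (N1 *v ((mat 1 + \<delta> *\<^sub>R N2_coeff) *v x))))"
      using k1 k1' mult_right_mono[OF k1(1), of "2 * (k1' * norm (N1 *v ((mat 1 + \<delta> *\<^sub>R N2_coeff) *v x)))"] by simp
    finally show "norm x \<le> 2 * k1 * k1' * norm ((N1 ** (mat 1 + \<delta> *\<^sub>R N2_coeff)) *v x)"
      by (simp add: matrix_vector_mul_assoc mult_ac)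
    have "\<delta>\<^sup>2 \<le> \<delta>" using \<delta> d0 by (simp add: power2_eq_square mult_left_le)
    then show "norm ((\<delta>\<^sup>2 *\<^sub>R N3_coeff) *v x) \<le> k3 * \<delta> * norm x"
      using k3 by (intro scaled_matrix_norm_le) auto
    show "norm (((B1 + \<delta> *\<^sub>R B0) ** (N1 ** (mat 1 + \<delta> *\<^sub>R N2_coeff) ** (mat 1 + \<delta>\<^sup>2 *\<^sub>R N3_coeff)) -
          N1 ** (mat 1 + \<delta> *\<^sub>R N2_coeff) ** (mat 1 + \<delta>\<^sup>2 *\<^sub>R N3_coeff) ** (first_diag0 + \<delta>\<^sup>2 *\<^sub>R first_diag2)) *v x)
         \<le> kQ * \<delta> ^ Suc 2 * norm x"
      unfolding U residual_third_order[OF first_identities] Q_def[symmetric]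
      using scaled_matrix_norm_le[OF kQ(2), of \<delta> "\<delta> ^ 3" "\<delta> ^ 3"] \<delta> d0 kQ by (simp add: numeral_3_eq_3)
    have "\<delta>\<^sup>2 \<le> (1 / 2)\<^sup>2" using \<delta> d0 by (intro power_mono) auto
    then have "\<delta>\<^sup>2 \<le> 1 / 2" by (simp add: power2_eq_square)
    then show "((first_diag0 + \<delta>\<^sup>2 *\<^sub>R first_diag2) *v x) \<bullet> x \<le> - (\<delta>\<^sup>2 / 2) * (norm x)\<^sup>2"
      unfolding diag3_scale diag3_plus by (intro diag3_dissipative) (auto simp: field_simps)
  qed (use d0 k3 kQ in auto)
  show ?thesis
  proof (rule that[OF q(1) _ q(3)])
    show "q0 \<le> 1" using q d0 by simp
    show "invertible (mat 1 + \<delta> *\<^sub>R N2_coeff)" if "0 < \<delta>" "\<delta> \<le> q0" for \<delta>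
      using IN2(2)[of \<delta>] that q by (intro invertible_if_bounded_below) auto
  qed (fact est)
qed

text \<open>The eigenvalues \<open>\<i>\<close> and \<open>- \<i>\<close> of \<open>B0\<close> get a negative real part, \<open>- \<delta>\<^sup>3 / 2\<close>, at third order
  only; the third mode is damped at the larger rate \<open>\<delta> - \<delta>\<^sup>3\<close>.\<close>

lemma second_profile_error:
  obtains q0 K where "0 < q0" "q0 \<le> 1" "K > 0"
    "\<And>\<delta>. 0 < \<delta> \<Longrightarrow> \<delta> \<le> q0 \<Longrightarrow> invertible (mat 1 + \<delta> *\<^sub>R N4_coeff)"
    "\<And>\<delta>. 0 < \<delta> \<Longrightarrow> \<delta> \<le> q0 \<Longrightarrow> invertible (mat 1 + \<delta>\<^sup>2 *\<^sub>R N5_coeff)"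
    "\<And>a \<delta> w v t. 0 < a \<Longrightarrow> 0 < \<delta> \<Longrightarrow> \<delta> \<le> q0 \<Longrightarrow>
      (\<And>t. t \<ge> 0 \<Longrightarrow> (w has_vector_derivative (a *\<^sub>R (B0 + \<delta> *\<^sub>R B1)) *v w t) (at t within {0..})) \<Longrightarrow>
      (\<And>t. t \<ge> 0 \<Longrightarrow> (v has_vector_derivative
          (a *\<^sub>R (B0 + \<delta> *\<^sub>R second_diag1 + \<delta>\<^sup>2 *\<^sub>R second_diag2 + \<delta> ^ 3 *\<^sub>R second_diag3)) *v v t) (at t within {0..})) \<Longrightarrow>
      ((mat 1 + \<delta> *\<^sub>R N4_coeff) ** (mat 1 + \<delta>\<^sup>2 *\<^sub>R N5_coeff)) *v v 0 = w 0 \<Longrightarrow> t \<ge> 0 \<Longrightarrow>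
      norm (w t - ((mat 1 + \<delta> *\<^sub>R N4_coeff) ** (mat 1 + \<delta>\<^sup>2 *\<^sub>R N5_coeff)) *v v t)
        \<le> K * \<delta> * exp (- (a * \<delta> ^ 3 / 8) * t) * norm (w 0)"
proof -
  obtain k4 where k4: "k4 \<ge> 1" "\<And>x. norm (N4_coeff *v x) \<le> k4 * norm x" using matrix_bounded by blast
  obtain k5 where k5: "k5 \<ge> 1" "\<And>x. norm (N5_coeff *v x) \<le> k5 * norm x" using matrix_bounded by blast
  obtain k6 where k6: "k6 \<ge> 1" "\<And>x. norm (N6_coeff *v x) \<le> k6 * norm x" using matrix_bounded by blast
  define d0 where "d0 = 1 / (2 * (k4 + k5))"
  have d0: "d0 > 0" "d0 \<le> 1 / 2" using k4 k5 by (auto simp: d0_def field_simps)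
  have small: "k4 * \<delta> \<le> 1 / 2" "k5 * \<delta> \<le> 1 / 2" if "0 < \<delta>" "\<delta> \<le> d0" for \<delta>
  proof -
    have "(k4 + k5) * \<delta> \<le> 1 / 2"
    proof -
      have "(k4 + k5) * d0 = 1 / 2" using k4 k5 by (simp add: d0_def divide_simps)
      moreover have "(k4 + k5) * \<delta> \<le> (k4 + k5) * d0" using k4 k5 that by (intro mult_left_mono) auto
      ultimately show ?thesis by linarith
    qed
    moreover have "0 \<le> k4 * \<delta>" "0 \<le> k5 * \<delta>" using k4 k5 that by auto
    ultimately show "k4 * \<delta> \<le> 1 / 2" "k5 * \<delta> \<le> 1 / 2" unfolding distrib_right by linarith+
  qed
  have pow: "\<delta>\<^sup>2 \<le> \<delta>" "\<delta> ^ 3 \<le> \<delta>" if "0 < \<delta>" "\<delta> \<le> d0" for \<delta>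
    using that d0 power_decreasing[of 1 2 \<delta>] power_decreasing[of 1 3 \<delta>] by auto
  have N4s: "norm ((\<delta> *\<^sub>R N4_coeff) *v x) \<le> k4 * \<delta> * norm x" if "0 < \<delta>" "\<delta> \<le> d0" for \<delta> x
    using scaled_matrix_norm_le[OF k4(2), of \<delta> \<delta>] that k4 by simp
  have N5s: "norm ((\<delta>\<^sup>2 *\<^sub>R N5_coeff) *v x) \<le> k5 * \<delta> * norm x" if "0 < \<delta>" "\<delta> \<le> d0" for \<delta> x
    using scaled_matrix_norm_le[OF k5(2), of "\<delta>\<^sup>2" \<delta>] pow[OF that] k5 by simp
  note IN4 = small_perturbation_of_identity[OF N4s small(1)]
  note IN5 = small_perturbation_of_identity[OF N5s small(2)]
  let ?V = "\<lambda>\<delta>. N4_coeff ** N6_coeff + \<delta> *\<^sub>R (N5_coeff ** N6_coeff) + \<delta>\<^sup>2 *\<^sub>R (N4_coeff ** N5_coeff ** N6_coeff)"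
  let ?U3 = "N4_coeff ** N5_coeff + N6_coeff"
  let ?D = "\<lambda>\<delta>. B0 + \<delta> *\<^sub>R second_diag1 + \<delta>\<^sup>2 *\<^sub>R second_diag2 + \<delta> ^ 3 *\<^sub>R second_diag3"
  define Q where "Q \<delta> = (B0 + \<delta> *\<^sub>R B1) ** ?V \<delta> - ?V \<delta> ** ?D \<delta> + B1 ** ?U3
    - ?U3 ** (second_diag1 + \<delta> *\<^sub>R second_diag2 + \<delta>\<^sup>2 *\<^sub>R second_diag3)
    - N5_coeff ** (second_diag2 + \<delta> *\<^sub>R second_diag3) - N4_coeff ** second_diag3" for \<delta>
  have "continuous_on {0..1} Q" unfolding Q_def by (intro continuous_intros)
  then obtain kQ where kQ: "kQ \<ge> 1" "\<And>\<delta> x. 0 \<le> \<delta> \<Longrightarrow> \<delta> \<le> 1 \<Longrightarrow> norm (Q \<delta> *v x) \<le> kQ * norm x"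
    using continuous_matrix_family_bounded by blast
  have U: "(mat 1 + \<delta> *\<^sub>R N4_coeff) ** (mat 1 + \<delta>\<^sup>2 *\<^sub>R N5_coeff) ** (mat 1 + \<delta> ^ 3 *\<^sub>R N6_coeff)
      = mat 1 + \<delta> *\<^sub>R N4_coeff + \<delta>\<^sup>2 *\<^sub>R N5_coeff + \<delta> ^ 3 *\<^sub>R ?U3 + \<delta> ^ 4 *\<^sub>R ?V \<delta>" for \<delta>
    by (simp add: matrix_expand scaleR_add_right power4_eq_xxxx power3_eq_cube power2_eq_square algebra_simps)
  have residual: "(B0 + \<delta> *\<^sub>R B1) ** (mat 1 + \<delta> *\<^sub>R N4_coeff + \<delta>\<^sup>2 *\<^sub>R N5_coeff + \<delta> ^ 3 *\<^sub>R ?U3 + \<delta> ^ 4 *\<^sub>R ?V \<delta>)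
      - (mat 1 + \<delta> *\<^sub>R N4_coeff + \<delta>\<^sup>2 *\<^sub>R N5_coeff + \<delta> ^ 3 *\<^sub>R ?U3 + \<delta> ^ 4 *\<^sub>R ?V \<delta>) ** ?D \<delta> = \<delta> ^ 4 *\<^sub>R Q \<delta>" for \<delta>
    unfolding Q_def
    by (rule residual_fourth_order) (simp_all only: mat1_mult second_identities)
  obtain q0 K where q: "0 < q0" "q0 \<le> d0" "K > 0"
    and est: "\<And>a \<delta> w v t. 0 < a \<Longrightarrow> 0 < \<delta> \<Longrightarrow> \<delta> \<le> q0 \<Longrightarrow>
      (\<And>t. t \<ge> 0 \<Longrightarrow> (w has_vector_derivative (a *\<^sub>R (B0 + \<delta> *\<^sub>R B1)) *v w t) (at t within {0..})) \<Longrightarrow>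
      (\<And>t. t \<ge> 0 \<Longrightarrow> (v has_vector_derivative (a *\<^sub>R ?D \<delta>) *v v t) (at t within {0..})) \<Longrightarrow>
      ((mat 1 + \<delta> *\<^sub>R N4_coeff) ** (mat 1 + \<delta>\<^sup>2 *\<^sub>R N5_coeff)) *v v 0 = w 0 \<Longrightarrow> t \<ge> 0 \<Longrightarrow>
      norm (w t - ((mat 1 + \<delta> *\<^sub>R N4_coeff) ** (mat 1 + \<delta>\<^sup>2 *\<^sub>R N5_coeff)) *v v t)
        \<le> K * \<delta> * exp (- (a * \<delta> ^ 3 / 8) * t) * norm (w 0)"
  proof (rule profile_error_of_diagonalisation[where p = 3 and ?d0.0 = d0 and ?K1.0 = 4 and ?K2.0 = k6
        and ?K3.0 = kQ and N = "\<lambda>\<delta>. \<delta> ^ 3 *\<^sub>R N6_coeff"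
        and T = "\<lambda>\<delta>. (mat 1 + \<delta> *\<^sub>R N4_coeff) ** (mat 1 + \<delta>\<^sup>2 *\<^sub>R N5_coeff)"
        and A = "\<lambda>\<delta>. B0 + \<delta> *\<^sub>R B1" and D = ?D])
    fix \<delta> :: real and x :: "complex^3" assume \<delta>: "0 < \<delta>" "\<delta> \<le> d0"
    show "norm (((mat 1 + \<delta> *\<^sub>R N4_coeff) ** (mat 1 + \<delta>\<^sup>2 *\<^sub>R N5_coeff)) *v x) \<le> 4 * norm x"
      using IN4(1)[OF \<delta> \<delta>, of "(mat 1 + \<delta>\<^sup>2 *\<^sub>R N5_coeff) *v x"] IN5(1)[OF \<delta> \<delta>, of x]
      by (simp add: matrix_vector_mul_assoc)
    show "norm x \<le> 4 * norm (((mat 1 + \<delta> *\<^sub>R N4_coeff) ** (mat 1 + \<delta>\<^sup>2 *\<^sub>R N5_coeff)) *v x)"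
      using IN4(2)[OF \<delta> \<delta>, of "(mat 1 + \<delta>\<^sup>2 *\<^sub>R N5_coeff) *v x"] IN5(2)[OF \<delta> \<delta>, of x]
      by (simp add: matrix_vector_mul_assoc)
    show "norm ((\<delta> ^ 3 *\<^sub>R N6_coeff) *v x) \<le> k6 * \<delta> * norm x"
      using k6 pow[OF \<delta>] \<delta> by (intro scaled_matrix_norm_le) auto
    show "norm (((B0 + \<delta> *\<^sub>R B1) ** ((mat 1 + \<delta> *\<^sub>R N4_coeff) ** (mat 1 + \<delta>\<^sup>2 *\<^sub>R N5_coeff) ** (mat 1 + \<delta> ^ 3 *\<^sub>R N6_coeff)) -
          (mat 1 + \<delta> *\<^sub>R N4_coeff) ** (mat 1 + \<delta>\<^sup>2 *\<^sub>R N5_coeff) ** (mat 1 + \<delta> ^ 3 *\<^sub>R N6_coeff) ** ?D \<delta>) *v x)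
         \<le> kQ * \<delta> ^ Suc 3 * norm x"
      unfolding U residual
      using scaled_matrix_norm_le[OF kQ(2), of \<delta> "\<delta> ^ 4" "\<delta> ^ 4"] \<delta> d0 kQ by (simp add: eval_nat_numeral)
    have "\<delta>\<^sup>2 \<le> 1 / 2" using pow(1)[OF \<delta>] \<delta> d0 by simp
    then have "\<delta> * \<delta>\<^sup>2 \<le> \<delta> * (1 / 2)" using \<delta> by (intro mult_left_mono) auto
    then have "\<delta> ^ 3 \<le> \<delta> / 2" by (simp add: power3_eq_cube power2_eq_square)
    then show "(?D \<delta> *v x) \<bullet> x \<le> - (\<delta> ^ 3 / 2) * (norm x)\<^sup>2"
      unfolding B0_def diag3_scale diag3_plus using \<delta> by (intro diag3_dissipative) (auto simp: field_simps)
  qed (use d0 k6 kQ in auto)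
  show ?thesis
  proof (rule that[OF q(1) _ q(3)])
    show "q0 \<le> 1" using q d0 by simp
    show "invertible (mat 1 + \<delta> *\<^sub>R N4_coeff)" if "0 < \<delta>" "\<delta> \<le> q0" for \<delta>
      using IN4(2)[of \<delta>] that q by (intro invertible_if_bounded_below) auto
    show "invertible (mat 1 + \<delta>\<^sup>2 *\<^sub>R N5_coeff)" if "0 < \<delta>" "\<delta> \<le> q0" for \<delta>
      using IN5(2)[of \<delta>] that q by (intro invertible_if_bounded_below) auto
  qed (fact est)
qed

section \<open>Measurability in the frequency\<close>

lemma borel_measurable_matrix_vector_mult [measurable (raw)]:
  fixes A :: "'a \<Rightarrow> complex^3^3"
  assumes "A \<in> borel_measurable M" "x \<in> borel_measurable M"
  shows "(\<lambda>\<xi>. A \<xi> *v x \<xi>) \<in> borel_measurable M"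
proof (rule borel_measurable_continuous_Pair[OF assms])
  show "continuous_on UNIV (\<lambda>p :: (complex^3^3) \<times> (complex^3). fst p *v snd p)"
    unfolding matrix_vector_mult_def by (intro continuous_intros)
qed

lemma borel_measurable_vector_scalar_mult [measurable (raw)]:
  fixes x :: "'a \<Rightarrow> complex^3"
  assumes "c \<in> borel_measurable M" "x \<in> borel_measurable M"
  shows "(\<lambda>\<xi>. c \<xi> *s x \<xi>) \<in> borel_measurable M"
proof (rule borel_measurable_continuous_Pair[OF assms])
  show "continuous_on UNIV (\<lambda>p :: complex \<times> (complex^3). fst p *s snd p)"
    unfolding vector_scalar_mult_def by (intro continuous_intros)
qed

text \<open>By Cramer's rule the solution of a regular system is a rational function of its coefficients.\<close>

lemma borel_measurable_matrix_inv_vector: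
  fixes A :: "'a \<Rightarrow> complex^3^3"
  assumes A[measurable]: "A \<in> borel_measurable M" and x[measurable]: "x \<in> borel_measurable M"
    and S[measurable]: "Measurable.pred M S" and inv: "\<And>\<xi>. S \<xi> \<Longrightarrow> invertible (A \<xi>)"
  shows "(\<lambda>\<xi>. if S \<xi> then matrix_inv (A \<xi>) *v x \<xi> else 0) \<in> borel_measurable M"
proof -
  have comp: "(\<lambda>\<xi>. f \<xi> $ i) \<in> borel_measurable M"
    if "f \<in> borel_measurable M" for f :: "'a \<Rightarrow> 'b::euclidean_space^3" and i
    using that by (rule borel_measurable_continuous_on[rotated]) (intro continuous_intros)
  define C where "C \<xi> = (\<chi> k. det (\<chi> i j. if j = k then x \<xi> $ i else A \<xi> $ i $ j) / det (A \<xi>))" for \<xi>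
  have "matrix_inv (A \<xi>) *v x \<xi> = C \<xi>" if "S \<xi>" for \<xi>
    using cramer[of "A \<xi>" "matrix_inv (A \<xi>) *v x \<xi>" "x \<xi>"] matrix_inv_mult_vec[OF inv[OF that]]
      inv[OF that] by (simp add: invertible_det_nz C_def)
  then have "(\<lambda>\<xi>. if S \<xi> then matrix_inv (A \<xi>) *v x \<xi> else 0) = (\<lambda>\<xi>. if S \<xi> then C \<xi> else 0)"
    by auto
  moreover have "C \<in> borel_measurable M"
  proof -
    have [measurable]: "(\<lambda>\<xi>. A \<xi> $ i $ j) \<in> borel_measurable M" "(\<lambda>\<xi>. x \<xi> $ i) \<in> borel_measurable M" for i j
      using comp[OF comp[OF A]] comp[OF x] by auto
    have [measurable]: "(\<lambda>\<xi>. if j = (k :: 3) then x \<xi> $ i else A \<xi> $ i $ j) \<in> borel_measurable M" for i j k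
      by (cases "j = k") auto
    show ?thesis
      unfolding C_def det_3 vec_lambda_beta
      by (subst borel_measurable_euclidean_space)
        (auto simp: Basis_vec_def inner_axis simp del: inner_complex_def intro!: borel_measurable_inner)
  qed
  ultimately show ?thesis by simp
qed

lemma borel_measurable_fourier:
  fixes f :: "real^'n \<Rightarrow> complex^3"
  assumes "integrable lborel f"
  shows "fourier f \<in> borel_measurable lborel"
proof -
  have [measurable]: "f \<in> borel_measurable lborel" using assms by auto
  show ?thesis
    unfolding fourier_def[abs_def] by measurable
qed

text \<open>Each Taylor polynomial of the solution is explicit in the coefficients and the initial value, and the
  error of one is the integral of the matrix applied to the error of the preceding one.  Uniqueness of the
  solution is part of the conclusion.\<close>

lemma linear_ode_taylor_limit:
  fixes A :: "complex^3^3" and W :: "real \<Rightarrow> complex^3"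
  assumes W: "\<And>t. t \<ge> 0 \<Longrightarrow> (W has_vector_derivative A *v W t) (at t within {0..})"
    and t: "t \<ge> 0"
  shows "(\<lambda>n. \<Sum>k<n. (t ^ k / fact k) *\<^sub>R (((*v) A ^^ k) (W 0))) \<longlonglongrightarrow> W t"
proof -
  define p where "p k = ((*v) A ^^ k) (W 0)" for k
  define S where "S n s = (\<Sum>k<n. (s ^ k / fact k) *\<^sub>R p k)" for n and s :: real
  define L where "L = onorm ((*v) A)"
  have L: "norm (A *v x) \<le> L * norm x" for x
    unfolding L_def by (rule onorm[OF matrix_vector_mul_bounded_linear])
  have L0: "L \<ge> 0" unfolding L_def by (rule onorm_pos_le[OF matrix_vector_mul_bounded_linear])
  have contW: "continuous_on {0..t} W"
  proof -
    have "continuous_on {0..} W"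
      using W by (intro continuous_on_vector_derivative) auto
    then show ?thesis by (rule continuous_on_subset) auto
  qed
  have "bounded (W ` {0..t})"
    by (intro compact_imp_bounded compact_continuous_image contW) auto
  then obtain B where B: "\<And>s. s \<in> {0..t} \<Longrightarrow> norm (W s) \<le> B"
    by (meson bounded_iff imageI)
  have dS: "(S (Suc n) has_vector_derivative A *v S n s) (at s)" for n s
  proof (induction n)
    case 0
    have "S (Suc 0) = (\<lambda>s. p 0)" by (auto simp: S_def)
    then show ?case by (simp add: S_def)
  next
    case (Suc n)
    have "((\<lambda>s. s ^ Suc n / fact (Suc n)) has_real_derivative s ^ n / fact n) (at s)"
      by (auto intro!: derivative_eq_intros simp: divide_simps simp del: power_Suc)
    then have "((\<lambda>s. (s ^ Suc n / fact (Suc n)) *\<^sub>R p (Suc n)) has_vector_derivative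
        (s ^ n / fact n) *\<^sub>R p (Suc n)) (at s)"
      unfolding has_real_derivative_iff_has_vector_derivative
      by (rule bounded_linear.has_vector_derivative[OF bounded_linear_scaleR_left])
    from has_vector_derivative_add[OF Suc this]
    show ?case
      by (simp add: S_def p_def matrix_vector_right_distrib
          linear_scale[OF bounded_linear.linear[OF matrix_vector_mul_bounded_linear]])
  qed
  have err: "norm (W s - S n s) \<le> B * (L * s) ^ n / fact n" if "s \<in> {0..t}" for n s
    using that
  proof (induction n arbitrary: s)
    case 0
    then show ?case using B by (simp add: S_def)
  next
    case (Suc n)
    have S0: "W 0 - S (Suc n) 0 = 0"
      by (simp add: S_def p_def lessThan_Suc_eq_insert_0 sum.reindex)
    show ?case
    proof (cases "s = 0")
      case True
      then show ?thesis using S0 by simp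
    next
      case False
      define \<phi> where "\<phi> x = B * L ^ Suc n * (x ^ Suc n / fact (Suc n))" for x :: real
      have "norm ((W s - S (Suc n) s) - (W 0 - S (Suc n) 0)) \<le> \<phi> s - \<phi> 0"
      proof (rule differentiable_bound_general)
        show "0 < s" using False Suc.prems by auto
        show "continuous_on {0..s} (\<lambda>x. W x - S (Suc n) x)"
          unfolding S_def
          by (intro continuous_intros continuous_on_subset[OF contW]) (use Suc.prems in auto)
        show "continuous_on {0..s} \<phi>" unfolding \<phi>_def by (intro continuous_intros) auto
        fix x assume x: "0 < x" "x < s"
        have "(W has_vector_derivative A *v W x) (at x)"
          using W[of x] x at_within_interior[of x "{0..}"] by simp
        then show "((\<lambda>x. W x - S (Suc n) x) has_vector_derivative (A *v W x - A *v S n x)) (at x)"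
          by (intro has_vector_derivative_diff dS)
        have "((\<lambda>x. x ^ Suc n / fact (Suc n)) has_real_derivative x ^ n / fact n) (at x)"
          by (auto intro!: derivative_eq_intros simp: divide_simps simp del: power_Suc)
        then have "(\<phi> has_real_derivative B * L ^ Suc n * (x ^ n / fact n)) (at x)"
          unfolding \<phi>_def by (intro DERIV_cmult)
        then show "(\<phi> has_vector_derivative B * L ^ Suc n * (x ^ n / fact n)) (at x)"
          by (simp add: has_real_derivative_iff_has_vector_derivative)
        have "norm (A *v W x - A *v S n x) \<le> L * norm (W x - S n x)"
          by (metis L matrix_vector_mult_diff_distrib)
        also have "\<dots> \<le> L * (B * (L * x) ^ n / fact n)"
          using x Suc.prems L0 by (intro mult_left_mono Suc.IH) auto
        finally show "norm (A *v W x - A *v S n x) \<le> B * L ^ Suc n * (x ^ n / fact n)"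
          by (simp add: power_mult_distrib mult_ac)
      qed
      then show ?thesis unfolding S0 by (simp add: \<phi>_def power_mult_distrib mult_ac)
    qed
  qed
  have "(\<lambda>n. (L * t) ^ n / fact n) \<longlonglongrightarrow> 0"
    using summable_LIMSEQ_zero[OF summable_exp[of "L * t"]] by (simp add: field_simps)
  then have "(\<lambda>n. B * (L * t) ^ n / fact n) \<longlonglongrightarrow> 0"
    using tendsto_mult_right_zero[of "\<lambda>n. (L * t) ^ n / fact n" sequentially B] by simp
  then have "(\<lambda>n. W t - S n t) \<longlonglongrightarrow> 0"
    by (rule Lim_null_comparison[rotated]) (use err[of t] t in auto)
  then have "(\<lambda>n. W t - (W t - S n t)) \<longlonglongrightarrow> W t - 0"
    by (intro tendsto_intros)
  then show ?thesis by (simp add: S_def p_def)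
qed

text \<open>The predicate \<open>S\<close> restricts the claim to frequencies at which the initial value is under control, since
  the initial values of the reference systems contain \<open>matrix_inv\<close>, which is arbitrary on singular
  matrices.\<close>

lemma borel_measurable_fourier_solution:
  fixes A :: "real^'n \<Rightarrow> complex^3^3" and W :: "real \<Rightarrow> real^'n \<Rightarrow> complex^3"
  assumes sol: "fourier_solution A g W" and A[measurable]: "A \<in> borel_measurable lborel"
    and g: "(\<lambda>\<xi>. if S \<xi> then g \<xi> else 0) \<in> borel_measurable lborel" and t: "t \<ge> 0"
  shows "(\<lambda>\<xi>. if S \<xi> then W t \<xi> else 0) \<in> borel_measurable lborel"
proof (rule borel_measurable_LIMSEQ_metric)
  let ?g = "\<lambda>\<xi>. if S \<xi> then g \<xi> else 0"
  have [measurable]: "(\<lambda>\<xi>. ((*v) (A \<xi>) ^^ k) (?g \<xi>)) \<in> borel_measurable lborel" for k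
    by (induction k) (use g in auto)
  show "(\<lambda>\<xi>. \<Sum>k<n. (t ^ k / fact k) *\<^sub>R (((*v) (A \<xi>) ^^ k) (?g \<xi>))) \<in> borel_measurable lborel" for n
    by measurable
next
  fix \<xi>
  let ?V = "\<lambda>\<tau>. if S \<xi> then W \<tau> \<xi> else 0"
  have "(?V has_vector_derivative A \<xi> *v ?V s) (at s within {0..})" if "s \<ge> 0" for s
    using sol that by (cases "S \<xi>") (auto simp: fourier_solution_def)
  from linear_ode_taylor_limit[OF this t]
  show "(\<lambda>n. \<Sum>k<n. (t ^ k / fact k) *\<^sub>R (((*v) (A \<xi>) ^^ k) (if S \<xi> then g \<xi> else 0)))
      \<longlonglongrightarrow> (if S \<xi> then W t \<xi> else 0)"
    using sol by (auto simp: fourier_solution_def)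
qed

lemma borel_measurable_matrix_mult [measurable (raw)]:
  fixes A B :: "'a \<Rightarrow> complex^3^3"
  assumes "A \<in> borel_measurable M" "B \<in> borel_measurable M"
  shows "(\<lambda>\<xi>. A \<xi> ** B \<xi>) \<in> borel_measurable M"
proof (rule borel_measurable_continuous_Pair[OF assms])
  show "continuous_on UNIV (\<lambda>p :: (complex^3^3) \<times> (complex^3^3). fst p ** snd p)"
    by (intro continuous_intros)
qed

section \<open>From pointwise bounds to decay rates\<close>

lemma powr_times_exp_bounded:
  fixes p c m :: real
  assumes "p \<ge> 0" "c > 0" "m > 0"
  obtains B where "B > 0" "\<And>x. x \<ge> 0 \<Longrightarrow> (1 + x) powr p * exp (- c * x powr m) \<le> B"
proof -
  have "((\<lambda>x. (1 + x) powr p * exp (- c * x powr m)) \<longlongrightarrow> 0) at_top"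
    using assms by real_asymp
  then have "eventually (\<lambda>x. (1 + x) powr p * exp (- c * x powr m) < 1) at_top"
    by (rule order_tendstoD) simp
  then obtain x0 where x0: "\<And>x. x \<ge> x0 \<Longrightarrow> (1 + x) powr p * exp (- c * x powr m) < 1"
    by (auto simp: eventually_at_top_linorder)
  show ?thesis
  proof
    show "1 + (1 + max 0 x0) powr p > 0" by (intro add_pos_nonneg) auto
    fix x :: real assume x: "x \<ge> 0"
    show "(1 + x) powr p * exp (- c * x powr m) \<le> 1 + (1 + max 0 x0) powr p"
    proof (cases "x \<ge> x0")
      case True
      then show ?thesis using x0[of x] powr_ge_zero[of "1 + max 0 x0" p] by linarith
    next
      case False
      have "(1 + x) powr p * exp (- c * x powr m) \<le> (1 + max 0 x0) powr p * 1"
        using False x assms by (intro mult_mono powr_mono2) auto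
      then show ?thesis by simp
    qed
  qed
qed

text \<open>With \<open>1 + t\<close> in place of \<open>t\<close> the integrand is, up to a power of \<open>\<rho> = (1 + t) powr (- 1 / m)\<close>,
  a function of \<open>\<bar>\<xi>\<bar> / \<rho>\<close>.  It is bounded by a series of multiples of indicators of the
  balls of radius \<open>\<rho> (j + 1)\<close>, whose volumes carry the factor \<open>\<rho>\<^sup>n\<close>.  This gives integrability and the scaling in \<open>t\<close> at once.\<close>

lemma low_frequency_integral_decay:
  fixes p c m :: real
  assumes p: "p \<ge> 0" and c: "c > 0" and m: "m > 0"
  shows "\<exists>C>0. \<forall>t\<ge>0.
    integrable lborel (\<lambda>\<xi> :: real^'n. indicator (cball 0 1) \<xi> * (norm \<xi> powr p * exp (- c * norm \<xi> powr m * t))) \<and>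
    (\<integral>\<xi>. indicator (cball 0 1) \<xi> * (norm \<xi> powr p * exp (- c * norm \<xi> powr m * t)) \<partial>(lborel :: (real^'n) measure))
      \<le> C * (1 + t) powr (- (real CARD('n) + p) / m)"
proof -
  define n where "n = CARD('n)"
  \<comment> \<open>Two powers more than \<open>n\<close>: the volumes use up \<open>n\<close> of them, and the other two make the series converge.\<close>
  obtain B where B: "B > 0" "\<And>x. x \<ge> 0 \<Longrightarrow> (1 + x) powr (p + real (n + 2)) * exp (- c * x powr m) \<le> B"
    using powr_times_exp_bounded[of "p + real (n + 2)" c m] assms by auto
  define \<omega> where "\<omega> = unit_ball_vol n"
  have \<omega>: "\<omega> > 0" by (simp add: \<omega>_def)
  define Z where "Z = (\<Sum>k. 1 / (real (Suc k))\<^sup>2)"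
  have Zsum: "summable (\<lambda>k. 1 / (real (Suc k))\<^sup>2)"
    using inverse_power_summable[of 2, where 'a = real]
    by (subst summable_Suc_iff) (simp add: divide_inverse)
  have Z: "Z > 0" unfolding Z_def by (intro suminf_pos Zsum) auto
  define C where "C = exp c * B * \<omega> * Z"
  have main: "(\<integral>\<^sup>+\<xi>. ennreal (indicator (cball 0 1) \<xi> * (norm \<xi> powr p * exp (- c * norm \<xi> powr m * t))) \<partial>(lborel :: (real^'n) measure))
      \<le> ennreal (C * (1 + t) powr (- (real CARD('n) + p) / m))" if t: "t \<ge> 0" for t
  proof -
    \<comment> \<open>The frequency at which the exponent is of order one.\<close>
    define \<rho> where "\<rho> = (1 + t) powr (- 1 / m)"
    have \<rho>: "\<rho> > 0" using t by (simp add: \<rho>_def)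
    have \<rho>m: "\<rho> powr m = 1 / (1 + t)"
    proof -
      have "\<rho> powr m = (1 + t) powr (- 1 / m * m)" unfolding \<rho>_def by (rule powr_powr)
      also have "- 1 / m * m = - 1" using m by simp
      finally show ?thesis using t by (simp add: powr_minus_divide)
    qed
    define a where "a k = exp c * B * \<rho> powr p / real (Suc k) ^ (n + 2)" for k
    have a0: "a k \<ge> 0" for k using B by (simp add: a_def)
    have pt: "ennreal (indicator (cball 0 1) \<xi> * (norm \<xi> powr p * exp (- c * norm \<xi> powr m * t)))
        \<le> (\<Sum>k. ennreal (a k) * indicator (ball 0 (\<rho> * Suc k)) \<xi>)" for \<xi> :: "real^'n"
    proof (cases "norm \<xi> \<le> 1")
      case True
      define x where "x = norm \<xi> / \<rho>"
      have x0: "x \<ge> 0" using \<rho> by (simp add: x_def)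
      define k where "k = nat \<lfloor>x\<rfloor>"
      have k: "real k \<le> x" "x < real (Suc k)" using x0 unfolding k_def by linarith+
      have nx: "norm \<xi> = \<rho> * x" using \<rho> by (simp add: x_def)
      have nm: "norm \<xi> powr m * (1 + t) = x powr m"
        using \<rho> x0 t by (simp add: nx powr_mult \<rho>m)
      have "norm \<xi> powr m \<le> 1 powr m" using True m by (intro powr_mono2) auto
      then have "c * norm \<xi> powr m \<le> c * 1" using c by (intro mult_left_mono) auto
      \<comment> \<open>On the unit ball \<open>t\<close> may be replaced by \<open>1 + t\<close> at the cost of the factor \<open>exp c\<close>.\<close>
      then have "- c * norm \<xi> powr m * t \<le> c + - c * x powr m"
        unfolding nm[symmetric] by (simp add: algebra_simps)
      then have e: "exp (- c * norm \<xi> powr m * t) \<le> exp c * exp (- c * x powr m)"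
        by (simp add: exp_add[symmetric])
      have "norm \<xi> powr p * exp (- c * norm \<xi> powr m * t) \<le> norm \<xi> powr p * (exp c * exp (- c * x powr m))"
        by (intro mult_left_mono e) auto
      also have "\<dots> = exp c * \<rho> powr p * (x powr p * exp (- c * x powr m))"
        using \<rho> x0 by (simp add: nx powr_mult)
      also have "\<dots> \<le> exp c * \<rho> powr p * (B / real (Suc k) ^ (n + 2))"
      proof (intro mult_left_mono)
        have "x powr p * exp (- c * x powr m) * real (Suc k) ^ (n + 2)
            \<le> (1 + x) powr p * exp (- c * x powr m) * (1 + x) ^ (n + 2)"
          using x0 k p by (intro mult_mono powr_mono2 power_mono) auto
        also have "\<dots> = (1 + x) powr (p + real (n + 2)) * exp (- c * x powr m)"
          using x0 powr_realpow[of "1 + x" "n + 2"] by (simp only: powr_add mult_ac)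
        also have "\<dots> \<le> B" by (rule B) fact
        finally have "x powr p * exp (- c * x powr m) * real (Suc k) ^ (n + 2) \<le> B" .
        then show "x powr p * exp (- c * x powr m) \<le> B / real (Suc k) ^ (n + 2)"
          by (subst pos_le_divide_eq) auto
      qed auto
      finally have le: "norm \<xi> powr p * exp (- c * norm \<xi> powr m * t) \<le> a k"
        by (simp add: a_def mult_ac)
      have "\<xi> \<in> ball 0 (\<rho> * Suc k)" using k \<rho> by (simp add: nx)
      then have "ennreal (indicator (cball 0 1) \<xi> * (norm \<xi> powr p * exp (- c * norm \<xi> powr m * t)))
          \<le> ennreal (a k) * indicator (ball 0 (\<rho> * Suc k)) \<xi>"
        using True le by (auto simp: indicator_def intro!: ennreal_leI)
      also have "\<dots> \<le> (\<Sum>k. ennreal (a k) * indicator (ball 0 (\<rho> * Suc k)) \<xi>)"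
      proof -
        define f where "f = (\<lambda>k. ennreal (a k) * indicator (ball 0 (\<rho> * Suc k)) \<xi>)"
        have "f k \<le> suminf f" using sum_le_suminf[of f "{k}"] by simp
        then show ?thesis unfolding f_def .
      qed
      finally show ?thesis .
    qed (simp add: indicator_def)
    have "(\<integral>\<^sup>+\<xi>. ennreal (indicator (cball 0 1) \<xi> * (norm \<xi> powr p * exp (- c * norm \<xi> powr m * t))) \<partial>(lborel :: (real^'n) measure))
        \<le> (\<integral>\<^sup>+\<xi>. (\<Sum>k. ennreal (a k) * indicator (ball 0 (\<rho> * Suc k)) \<xi>) \<partial>(lborel :: (real^'n) measure))"
      by (intro nn_integral_mono pt)
    also have "\<dots> = (\<Sum>k. ennreal (a k) * emeasure lborel (ball (0 :: real^'n) (\<rho> * Suc k)))"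
      by (subst nn_integral_suminf)
        (auto simp: nn_integral_cmult_indicator intro!: borel_measurable_times_ennreal borel_measurable_indicator)
    also have "\<dots> = (\<Sum>k. ennreal (exp c * B * \<omega> * \<rho> powr (n + p) * (1 / (real (Suc k))\<^sup>2)))"
    proof (intro suminf_cong)
      fix k
      have "emeasure lborel (ball (0 :: real^'n) (\<rho> * Suc k)) = ennreal (\<omega> * (\<rho> * Suc k) ^ n)"
        using \<rho> by (subst emeasure_ball) (auto simp: \<omega>_def n_def)
      then have "ennreal (a k) * emeasure lborel (ball (0 :: real^'n) (\<rho> * Suc k))
          = ennreal (a k * (\<omega> * (\<rho> * Suc k) ^ n))"
        using a0 by (simp add: ennreal_mult')
      also have "a k * (\<omega> * (\<rho> * Suc k) ^ n) = exp c * B * \<omega> * \<rho> powr (n + p) * (1 / (real (Suc k))\<^sup>2)"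
        using \<rho> by (simp add: a_def powr_add powr_realpow power_mult_distrib power_add power2_eq_square mult_ac del: of_nat_Suc)
      finally show "ennreal (a k) * emeasure lborel (ball (0 :: real^'n) (\<rho> * Suc k)) =
          ennreal (exp c * B * \<omega> * \<rho> powr (n + p) * (1 / (real (Suc k))\<^sup>2))" .
    qed
    also have "\<dots> = ennreal (exp c * B * \<omega> * \<rho> powr (n + p) * Z)"
    proof (subst suminf_ennreal2[OF _ summable_mult[OF Zsum]])
      show "0 \<le> exp c * B * \<omega> * \<rho> powr (n + p) * (1 / (real (Suc k))\<^sup>2)" for k using B \<omega> by simp
    qed (simp only: Z_def suminf_mult[OF Zsum])
    also have "exp c * B * \<omega> * \<rho> powr (n + p) * Z = C * (1 + t) powr (- (real CARD('n) + p) / m)"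
    proof -
      have "- 1 / m * (n + p) = - (real CARD('n) + p) / m" by (simp add: n_def divide_simps)
      then show ?thesis by (simp only: C_def \<rho>_def powr_powr mult_ac)
    qed
    finally show ?thesis .
  qed
  have int: "integrable lborel (\<lambda>\<xi> :: real^'n. indicator (cball 0 1) \<xi> * (norm \<xi> powr p * exp (- c * norm \<xi> powr m * t)))"
    if "t \<ge> 0" for t
  proof (rule integrableI_nonneg)
    show "(\<integral>\<^sup>+\<xi>. ennreal (indicator (cball 0 1) \<xi> * (norm \<xi> powr p * exp (- c * norm \<xi> powr m * t))) \<partial>(lborel :: (real^'n) measure)) < \<infinity>"
      using main[OF that] by (rule order_le_less_trans) simp
    show "(\<lambda>\<xi> :: real^'n. indicator (cball 0 1) \<xi> * (norm \<xi> powr p * exp (- c * norm \<xi> powr m * t))) \<in> borel_measurable lborel"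
      by (intro borel_measurable_times borel_measurable_indicator borel_measurable_exp) auto
  qed auto
  show ?thesis
  proof (intro exI[of _ C] conjI allI impI int)
    show "C > 0" using B \<omega> Z by (simp add: C_def)
    fix t :: real assume t: "t \<ge> 0"
    have "ennreal (\<integral>\<xi>. indicator (cball 0 1) \<xi> * (norm \<xi> powr p * exp (- c * norm \<xi> powr m * t)) \<partial>(lborel :: (real^'n) measure))
        \<le> ennreal (C * (1 + t) powr (- (real CARD('n) + p) / m))"
      using main[OF t] by (subst nn_integral_eq_integral[OF int[OF t], symmetric]) auto
    then show "(\<integral>\<xi>. indicator (cball 0 1) \<xi> * (norm \<xi> powr p * exp (- c * norm \<xi> powr m * t)) \<partial>(lborel :: (real^'n) measure))
        \<le> C * (1 + t) powr (- (real CARD('n) + p) / m)"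
      using B \<omega> Z by (subst (asm) ennreal_le_iff) (auto simp: C_def)
  qed
qed


lemma norm_vector_scalar_mult:
  fixes x :: "complex^3"
  shows "norm (c *s x) = norm c * norm x"
  by (simp add: norm_vec_def norm_mult L2_set_right_distrib)

text \<open>Interpolation between the bounds 2 and \<open>\<bar>\<theta>\<bar>\<close>.\<close>

lemma norm_character_minus_one_le:
  fixes \<theta> \<kappa> :: real
  assumes "0 \<le> \<kappa>" "\<kappa> \<le> 1"
  shows "norm (exp (- (\<i> * of_real \<theta>)) - 1) \<le> 2 * \<bar>\<theta>\<bar> powr \<kappa>"
proof -
  have "norm (exp (\<i> * of_real (- \<theta>)) - 1) = 2 * \<bar>sin (- \<theta> / 2)\<bar>"
    using dist_exp_i_1[of "- \<theta>"] by (simp add: dist_norm)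
  also have "\<dots> \<le> 2 * \<bar>- \<theta> / 2\<bar>" by (intro mult_left_mono abs_sin_x_le_abs_x) auto
  finally have 1: "norm (exp (- (\<i> * of_real \<theta>)) - 1) \<le> \<bar>\<theta>\<bar>" by simp
  have 2: "norm (exp (- (\<i> * of_real \<theta>)) - 1) \<le> 2"
    using norm_triangle_ineq4[of "exp (- (\<i> * of_real \<theta>))" 1] norm_exp_i_times[of "- \<theta>"] by simp
  show ?thesis
  proof (cases "\<theta> = 0 \<or> \<bar>\<theta>\<bar> \<ge> 1")
    case True
    then show ?thesis using 2 ge_one_powr_ge_zero[of "\<bar>\<theta>\<bar>" \<kappa>] assms by auto
  next
    case False
    then have "\<bar>\<theta>\<bar> powr 1 \<le> \<bar>\<theta>\<bar> powr \<kappa>" using assms by (intro powr_mono') auto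
    then show ?thesis using 1 False by auto
  qed
qed

text \<open>Subtracting the mean replaces the character by its difference to 1, which gains the power
  \<open>\<bar>\<xi>\<bar> powr \<kappa>\<close> at the cost of the weight.\<close>

lemma fourier_low_frequency_bound:
  fixes f :: "real^'n \<Rightarrow> complex^3"
  assumes f: "integrable lborel f" and fw: "f \<in> weighted_L1 \<kappa>" and \<kappa>: "0 \<le> \<kappa>" "\<kappa> \<le> 1"
  shows "norm (fourier f \<xi>) \<le> 2 * (norm \<xi> powr \<kappa> * weighted_L1_norm \<kappa> f + norm (mean f))"
proof -
  define e where "e x = exp (- (\<i> * complex_of_real (x \<bullet> \<xi>)))" for x
  have [measurable]: "f \<in> borel_measurable lborel" "e \<in> borel_measurable lborel"
    using f by (auto simp: e_def[abs_def])
  have e1: "norm (e x) = 1" for x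
    using norm_exp_i_times[of "- (x \<bullet> \<xi>)"] by (simp add: e_def)
  have ef: "integrable lborel (\<lambda>x. e x *s f x)"
    by (rule Bochner_Integration.integrable_bound[OF f]) (auto simp: norm_vector_scalar_mult e1)
  have wf: "integrable lborel (\<lambda>x. (1 + norm x) powr \<kappa> * norm (f x))"
    using integrable_norm[OF fw[unfolded weighted_L1_def mem_Collect_eq]] by simp
  have "norm ((\<integral>x. e x *s f x \<partial>lborel) - mean f) = norm (\<integral>x. e x *s f x - f x \<partial>lborel)"
    unfolding mean_def using ef f by simp
  also have "\<dots> \<le> (\<integral>x. 2 * norm \<xi> powr \<kappa> * ((1 + norm x) powr \<kappa> * norm (f x)) \<partial>lborel)"
  proof (rule Bochner_Integration.integral_norm_bound_integral)
    fix x :: "real^'n"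
    have "norm (e x *s f x - f x) = norm (e x - 1) * norm (f x)"
      by (simp add: norm_vector_scalar_mult[symmetric] vector_sub_rdistrib)
    also have "\<dots> \<le> (2 * (norm \<xi> powr \<kappa> * (1 + norm x) powr \<kappa>)) * norm (f x)"
    proof (intro mult_right_mono)
      have "norm (e x - 1) \<le> 2 * \<bar>x \<bullet> \<xi>\<bar> powr \<kappa>"
        unfolding e_def by (rule norm_character_minus_one_le[OF \<kappa>])
      also have "\<bar>x \<bullet> \<xi>\<bar> powr \<kappa> \<le> (norm \<xi> * (1 + norm x)) powr \<kappa>"
        using Cauchy_Schwarz_ineq2[of x \<xi>] \<kappa>
        by (intro powr_mono2) (auto simp: algebra_simps intro: add_increasing)
      also have "\<dots> = norm \<xi> powr \<kappa> * (1 + norm x) powr \<kappa>" by (simp add: powr_mult)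
      finally show "norm (e x - 1) \<le> 2 * (norm \<xi> powr \<kappa> * (1 + norm x) powr \<kappa>)" by simp
    qed auto
    finally show "norm (e x *s f x - f x) \<le> 2 * norm \<xi> powr \<kappa> * ((1 + norm x) powr \<kappa> * norm (f x))"
      by (simp add: mult_ac)
  qed (use ef f wf in auto)
  also have "\<dots> = 2 * norm \<xi> powr \<kappa> * weighted_L1_norm \<kappa> f"
    by (simp add: weighted_L1_norm_def)
  finally have b: "norm (\<integral>x. e x *s f x \<partial>lborel) \<le> 2 * norm \<xi> powr \<kappa> * weighted_L1_norm \<kappa> f + norm (mean f)"
    using norm_triangle_sub[of "\<integral>x. e x *s f x \<partial>lborel" "mean f"] by linarith
  have "1 / (2 * pi) powr (real CARD('n) / 2) \<le> 1"
    using ge_one_powr_ge_zero[of "2 * pi" "real CARD('n) / 2"] pi_ge_two by simp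
  then have "norm (fourier f \<xi>) \<le> 1 * norm (\<integral>x. e x *s f x \<partial>lborel)"
    unfolding fourier_def e_def[symmetric] norm_scaleR by (intro mult_right_mono) auto
  then show ?thesis using b norm_ge_zero[of "mean f"] unfolding distrib_left mult_1 mult.assoc by linarith
qed

text \<open>Squaring and integrating the pointwise bound leaves two integrals of the form just treated, with
  exponents \<open>2 (s0 + k + \<kappa>)\<close> and \<open>2 (s0 + k)\<close>.  The constant is independent of the function, of \<open>t\<close> and
  of the data \<open>a\<close> and \<open>b\<close>.\<close>

lemma Hdot_decay_of_pointwise_bound:
  fixes c m k s0 \<kappa> K :: real
  assumes c: "c > 0" and m: "m > 0" and k: "k \<ge> 0" and s0: "s0 \<ge> 0" and \<kappa>: "0 \<le> \<kappa>" and K: "K \<ge> 0"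
  obtains C where "C > 0"
    "\<And>(d :: real^'n \<Rightarrow> complex^3) a b t. d \<in> borel_measurable lborel \<Longrightarrow> a \<ge> 0 \<Longrightarrow> b \<ge> 0 \<Longrightarrow> t \<ge> 0 \<Longrightarrow>
      (\<And>\<xi>. \<xi> \<noteq> 0 \<Longrightarrow> norm (d \<xi>) \<le> K * (indicator (cball 0 1) \<xi> * norm \<xi> powr k * exp (- c * norm \<xi> powr m * t))
           * (norm \<xi> powr \<kappa> * a + b)) \<Longrightarrow>
      in_Hdot_hat s0 d \<and> Hdot_norm_hat s0 d \<le>
        C * ((1 + t) powr (- ((real CARD('n) + 2 * (s0 + \<kappa>)) / (2 * m)) - k / m) * a
           + (1 + t) powr (- ((real CARD('n) + 2 * s0) / (2 * m)) - k / m) * b)"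
proof -
  have square: "(x + y)\<^sup>2 \<le> 4 * (x\<^sup>2 + y\<^sup>2)" for x y :: real
  proof -
    have "0 \<le> (x - y)\<^sup>2 + 2 * x\<^sup>2 + 2 * y\<^sup>2" by simp
    then show ?thesis by (simp add: power2_eq_square algebra_simps)
  qed
  define p where "p \<mu> = 2 * (s0 + k + \<mu>)" for \<mu>
  define G where "G \<mu> t = (\<lambda>\<xi> :: real^'n. indicator (cball 0 1) \<xi> * (norm \<xi> powr p \<mu> * exp (- (2 * c) * norm \<xi> powr m * t)))"
    for \<mu> t
  have "\<exists>C>0. \<forall>t\<ge>0. integrable lborel (G \<mu> t) \<and> integral\<^sup>L lborel (G \<mu> t) \<le> C * (1 + t) powr (- (real CARD('n) + p \<mu>) / m)"
    if "\<mu> \<ge> 0" for \<mu>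
  proof -
    have "p \<mu> \<ge> 0" "2 * c > 0" using that c k s0 by (auto simp: p_def)
    from low_frequency_integral_decay[OF this m, where ?'n = 'n] show ?thesis
      unfolding G_def .
  qed
  from this[OF \<kappa>] this[of 0] obtain C1 C2 where C: "C1 > 0" "C2 > 0"
    and C1: "\<And>t. t \<ge> 0 \<Longrightarrow> integrable lborel (G \<kappa> t)" "\<And>t. t \<ge> 0 \<Longrightarrow> integral\<^sup>L lborel (G \<kappa> t) \<le> C1 * (1 + t) powr (- (real CARD('n) + p \<kappa>) / m)"
    and C2: "\<And>t. t \<ge> 0 \<Longrightarrow> integrable lborel (G 0 t)" "\<And>t. t \<ge> 0 \<Longrightarrow> integral\<^sup>L lborel (G 0 t) \<le> C2 * (1 + t) powr (- (real CARD('n) + p 0) / m)"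
    by auto
  define C where "C = 1 + 2 * K * (sqrt C1 + sqrt C2)"
  have C_ge: "2 * K * sqrt C1 \<le> C" "2 * K * sqrt C2 \<le> C"
    using C K by (auto simp: C_def algebra_simps intro: add_increasing add_increasing2)
  show ?thesis
  proof
    show "C > 0" using C K by (auto simp: C_def intro!: add_pos_nonneg)
    fix d :: "real^'n \<Rightarrow> complex^3" and a b t :: real
    assume d[measurable]: "d \<in> borel_measurable lborel" and a: "a \<ge> 0" and b: "b \<ge> 0" and t: "t \<ge> 0"
      and bound: "\<And>\<xi>. \<xi> \<noteq> 0 \<Longrightarrow> norm (d \<xi>) \<le> K * (indicator (cball 0 1) \<xi> * norm \<xi> powr k * exp (- c * norm \<xi> powr m * t))
           * (norm \<xi> powr \<kappa> * a + b)"
    define h where "h \<xi> = norm \<xi> powr s0 *\<^sub>R d \<xi>" for \<xi>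
    have [measurable]: "h \<in> borel_measurable lborel" unfolding h_def by measurable
    have pt: "(norm (h \<xi>))\<^sup>2 \<le> 4 * K\<^sup>2 * (a\<^sup>2 * G \<kappa> t \<xi> + b\<^sup>2 * G 0 t \<xi>)" for \<xi>
    proof (cases "\<xi> = 0")
      case True
      then show ?thesis by (simp add: h_def G_def)
    next
      case False
      define E where "E = norm \<xi> powr (s0 + k) * exp (- c * norm \<xi> powr m * t)"
      define I :: real where "I = indicator (cball 0 1) \<xi>"
      have I: "I\<^sup>2 = I" by (simp add: I_def indicator_def)
      have "norm (h \<xi>) \<le> norm \<xi> powr s0 * (K * (I * norm \<xi> powr k * exp (- c * norm \<xi> powr m * t))
           * (norm \<xi> powr \<kappa> * a + b))"
        unfolding h_def I_def using bound[OF False] by (simp add: mult_left_mono)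
      also have "\<dots> = K * I * E * (norm \<xi> powr \<kappa> * a + b)"
        by (simp add: E_def powr_add mult_ac)
      finally have "(norm (h \<xi>))\<^sup>2 \<le> (K * I * E * (norm \<xi> powr \<kappa> * a + b))\<^sup>2"
        by (intro power_mono) auto
      also have "\<dots> = K\<^sup>2 * I * E\<^sup>2 * (norm \<xi> powr \<kappa> * a + b)\<^sup>2"
        by (simp add: power_mult_distrib I)
      also have "\<dots> \<le> K\<^sup>2 * I * E\<^sup>2 * (4 * ((norm \<xi> powr \<kappa> * a)\<^sup>2 + b\<^sup>2))"
      proof (intro mult_left_mono)
        show "(norm \<xi> powr \<kappa> * a + b)\<^sup>2 \<le> 4 * ((norm \<xi> powr \<kappa> * a)\<^sup>2 + b\<^sup>2)"
          by (rule square)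
      qed (auto simp: I_def)
      also have "\<dots> = 4 * K\<^sup>2 * (a\<^sup>2 * (I * E\<^sup>2 * (norm \<xi> powr \<kappa>)\<^sup>2) + b\<^sup>2 * (I * E\<^sup>2))"
        by (simp add: algebra_simps power_mult_distrib)
      also have "I * E\<^sup>2 * (norm \<xi> powr \<kappa>)\<^sup>2 = G \<kappa> t \<xi>"
        using False by (simp add: I_def E_def G_def p_def power2_eq_square exp_add[symmetric] powr_add[symmetric] algebra_simps)
      also have "I * E\<^sup>2 = G 0 t \<xi>"
        using False by (simp add: I_def E_def G_def p_def power2_eq_square exp_add[symmetric] powr_add[symmetric] algebra_simps)
      finally show ?thesis .
    qed
    have intG: "integrable lborel (\<lambda>\<xi>. 4 * K\<^sup>2 * (a\<^sup>2 * G \<kappa> t \<xi> + b\<^sup>2 * G 0 t \<xi>))"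
      using C1(1)[OF t] C2(1)[OF t] by auto
    have inth: "integrable lborel (\<lambda>\<xi>. (norm (h \<xi>))\<^sup>2)"
      by (rule Bochner_Integration.integrable_bound[OF intG])
        (use pt in \<open>auto intro: order_trans[OF _ abs_ge_self]\<close>)
    then have "in_Hdot_hat s0 d"
      unfolding in_Hdot_hat_def in_L2_def h_def[symmetric] by auto
    moreover have "Hdot_norm_hat s0 d \<le>
        C * ((1 + t) powr (- ((real CARD('n) + 2 * (s0 + \<kappa>)) / (2 * m)) - k / m) * a
           + (1 + t) powr (- ((real CARD('n) + 2 * s0) / (2 * m)) - k / m) * b)"
    proof -
      define x y where "x = (1 + t) powr (- ((real CARD('n) + 2 * (s0 + \<kappa>)) / (2 * m)) - k / m)"
        and "y = (1 + t) powr (- ((real CARD('n) + 2 * s0) / (2 * m)) - k / m)"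
      have xy0: "x \<ge> 0" "y \<ge> 0" by (auto simp: x_def y_def)
      have sq: "((1 + t) powr z)\<^sup>2 = (1 + t) powr (2 * z)" for z
        by (simp add: power2_eq_square powr_add[symmetric])
      have x2: "(1 + t) powr (- (real CARD('n) + p \<kappa>) / m) = x\<^sup>2"
        unfolding x_def sq p_def using m by (intro arg_cong2[where f = "(powr)"]) (auto simp: field_simps)
      have y2: "(1 + t) powr (- (real CARD('n) + p 0) / m) = y\<^sup>2"
        unfolding y_def sq p_def using m by (intro arg_cong2[where f = "(powr)"]) (auto simp: field_simps)
      have "(\<integral>\<xi>. (norm (h \<xi>))\<^sup>2 \<partial>lborel) \<le> (\<integral>\<xi>. 4 * K\<^sup>2 * (a\<^sup>2 * G \<kappa> t \<xi> + b\<^sup>2 * G 0 t \<xi>) \<partial>lborel)"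
        by (intro integral_mono inth intG pt)
      also have "\<dots> = 4 * K\<^sup>2 * (a\<^sup>2 * integral\<^sup>L lborel (G \<kappa> t) + b\<^sup>2 * integral\<^sup>L lborel (G 0 t))"
        using C1(1)[OF t] C2(1)[OF t] by simp
      also have "\<dots> \<le> 4 * K\<^sup>2 * (a\<^sup>2 * (C1 * x\<^sup>2) + b\<^sup>2 * (C2 * y\<^sup>2))"
        using C1(2)[OF t] C2(2)[OF t] unfolding x2 y2 by (intro mult_left_mono add_mono) auto
      also have "\<dots> = (2 * K * sqrt C1 * x * a)\<^sup>2 + (2 * K * sqrt C2 * y * b)\<^sup>2"
        using C by (simp add: power_mult_distrib algebra_simps)
      also have "\<dots> \<le> (2 * K * sqrt C1 * x * a + 2 * K * sqrt C2 * y * b)\<^sup>2"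
      proof -
        have "0 \<le> 2 * (2 * K * sqrt C1 * x * a) * (2 * K * sqrt C2 * y * b)"
          using C K a b xy0 by simp
        then show ?thesis unfolding power2_sum by linarith
      qed
      finally have "Hdot_norm_hat s0 d \<le> 2 * K * sqrt C1 * x * a + 2 * K * sqrt C2 * y * b"
        unfolding Hdot_norm_hat_def L2_norm_def h_def[symmetric]
        using C K a b xy0 by (intro real_le_lsqrt) auto
      also have "\<dots> \<le> C * (x * a) + C * (y * b)"
        using mult_right_mono[OF C_ge(1), of "x * a"] mult_right_mono[OF C_ge(2), of "y * b"] a b xy0
        by (simp add: mult_ac)
      finally show ?thesis by (simp add: x_def y_def algebra_simps)
    qed
    ultimately show "in_Hdot_hat s0 d \<and> Hdot_norm_hat s0 d \<le>
        C * ((1 + t) powr (- ((real CARD('n) + 2 * (s0 + \<kappa>)) / (2 * m)) - k / m) * a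
           + (1 + t) powr (- ((real CARD('n) + 2 * s0) / (2 * m)) - k / m) * b)" by blast
  qed
qed

text \<open>What remains to be shown for a profile is one pointwise inequality on the support of the cut-off, away
  from the origin.\<close>

lemma low_frequency_profile_estimate:
  fixes \<chi>int :: "real^'n \<Rightarrow> real" and c m k s0 \<kappa> K \<epsilon> :: real
  assumes c: "c > 0" and m: "m > 0" and k: "k \<ge> 0" and s0: "s0 \<ge> 0" and \<kappa>: "0 \<le> \<kappa>" "\<kappa> \<le> 1" and K: "K \<ge> 0"
    and \<epsilon>: "\<epsilon> \<le> 1" and \<chi>int: "continuous_on UNIV \<chi>int" and supp: "fn_support \<chi>int \<subseteq> {\<xi>. norm \<xi> \<le> \<epsilon>}"
  obtains C where "C > 0"
    "\<And>w0 A D T g W V t. integrable lborel w0 \<Longrightarrow> w0 \<in> weighted_L1 \<kappa> \<Longrightarrow>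
      fourier_solution A (fourier w0) W \<Longrightarrow> fourier_solution D g V \<Longrightarrow>
      A \<in> borel_measurable lborel \<Longrightarrow> D \<in> borel_measurable lborel \<Longrightarrow> T \<in> borel_measurable lborel \<Longrightarrow>
      (\<lambda>\<xi>. if norm \<xi> \<le> \<epsilon> then g \<xi> else 0) \<in> borel_measurable lborel \<Longrightarrow> t \<ge> 0 \<Longrightarrow>
      (\<And>\<xi>. \<xi> \<noteq> 0 \<Longrightarrow> norm \<xi> \<le> \<epsilon> \<Longrightarrow> norm (W t \<xi> - T \<xi> *v V t \<xi>)
         \<le> K * norm \<xi> powr k * exp (- c * norm \<xi> powr m * t) * norm (fourier w0 \<xi>)) \<Longrightarrow>
      in_Hdot_hat s0 (\<lambda>\<xi>. \<chi>int \<xi> *\<^sub>R W t \<xi> - \<chi>int \<xi> *\<^sub>R (T \<xi> *v V t \<xi>)) \<and>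
      Hdot_norm_hat s0 (\<lambda>\<xi>. \<chi>int \<xi> *\<^sub>R W t \<xi> - \<chi>int \<xi> *\<^sub>R (T \<xi> *v V t \<xi>))
        \<le> C * ((1 + t) powr (- ((real CARD('n) + 2 * (s0 + \<kappa>)) / (2 * m)) - k / m) * weighted_L1_norm \<kappa> w0
           + (1 + t) powr (- ((real CARD('n) + 2 * s0) / (2 * m)) - k / m) * norm (mean w0))"
proof -
  have supp0: "norm \<xi> \<le> \<epsilon>" if "\<chi>int \<xi> \<noteq> 0" for \<xi>
    using supp closure_subset[of "{\<xi>. \<chi>int \<xi> \<noteq> 0}"] that unfolding fn_support_def by blast
  have "bounded (\<chi>int ` cball 0 \<epsilon>)"
    by (intro compact_imp_bounded compact_continuous_image continuous_on_subset[OF \<chi>int]) auto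
  then obtain X where "\<forall>\<xi>\<in>cball 0 \<epsilon>. \<bar>\<chi>int \<xi>\<bar> \<le> X"
    unfolding bounded_iff by auto
  then have X: "\<bar>\<chi>int \<xi>\<bar> \<le> X" if "norm \<xi> \<le> \<epsilon>" for \<xi>
    using that by simp
  define X' where "X' = max X 0"
  have X': "\<bar>\<chi>int \<xi>\<bar> \<le> X' * indicator (cball 0 \<epsilon>) \<xi>" for \<xi>
    using X[of \<xi>] supp0[of \<xi>] by (cases "norm \<xi> \<le> \<epsilon>") (auto simp: X'_def max_def)
  have "X' * K * 2 \<ge> 0" using K by (simp add: X'_def)
  from Hdot_decay_of_pointwise_bound[OF c m k s0 \<kappa>(1) this, where ?'n = 'n]
  obtain C where C: "C > 0"
    and decay: "\<And>(d :: real^'n \<Rightarrow> complex^3) a b t. d \<in> borel_measurable lborel \<Longrightarrow> a \<ge> 0 \<Longrightarrow> b \<ge> 0 \<Longrightarrow> t \<ge> 0 \<Longrightarrow>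
      (\<And>\<xi>. \<xi> \<noteq> 0 \<Longrightarrow> norm (d \<xi>) \<le> (X' * K * 2) * (indicator (cball 0 1) \<xi> * norm \<xi> powr k * exp (- c * norm \<xi> powr m * t))
           * (norm \<xi> powr \<kappa> * a + b)) \<Longrightarrow>
      in_Hdot_hat s0 d \<and> Hdot_norm_hat s0 d \<le>
        C * ((1 + t) powr (- ((real CARD('n) + 2 * (s0 + \<kappa>)) / (2 * m)) - k / m) * a
           + (1 + t) powr (- ((real CARD('n) + 2 * s0) / (2 * m)) - k / m) * b)" by metis
  show ?thesis
  proof (rule that[OF C])
    fix w0 :: "real^'n \<Rightarrow> complex^3" and A D T g W V and t :: real
    assume int: "integrable lborel w0" and w0: "w0 \<in> weighted_L1 \<kappa>"
      and W: "fourier_solution A (fourier w0) W" and V: "fourier_solution D g V"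
      and meas[measurable]: "A \<in> borel_measurable lborel" "D \<in> borel_measurable lborel" "T \<in> borel_measurable lborel"
      and g: "(\<lambda>\<xi>. if norm \<xi> \<le> \<epsilon> then g \<xi> else 0) \<in> borel_measurable lborel" and t: "t \<ge> 0"
      and bound: "\<And>\<xi>. \<xi> \<noteq> 0 \<Longrightarrow> norm \<xi> \<le> \<epsilon> \<Longrightarrow> norm (W t \<xi> - T \<xi> *v V t \<xi>)
         \<le> K * norm \<xi> powr k * exp (- c * norm \<xi> powr m * t) * norm (fourier w0 \<xi>)"
    let ?d = "\<lambda>\<xi>. \<chi>int \<xi> *\<^sub>R W t \<xi> - \<chi>int \<xi> *\<^sub>R (T \<xi> *v V t \<xi>)"
    have [measurable]: "\<chi>int \<in> borel_measurable lborel"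
      using borel_measurable_continuous_onI[OF \<chi>int] by simp
    have [measurable]: "W t \<in> borel_measurable lborel"
      using borel_measurable_fourier_solution[OF W meas(1) _ t, of "\<lambda>_. True"] borel_measurable_fourier[OF int] by simp
    have [measurable]: "(\<lambda>\<xi>. if norm \<xi> \<le> \<epsilon> then V t \<xi> else 0) \<in> borel_measurable lborel"
      by (rule borel_measurable_fourier_solution[OF V meas(2) g t])
    have "(\<lambda>\<xi>. \<chi>int \<xi> *\<^sub>R W t \<xi> - \<chi>int \<xi> *\<^sub>R (T \<xi> *v (if norm \<xi> \<le> \<epsilon> then V t \<xi> else 0))) \<in> borel_measurable lborel"
      by measurable
    also have "(\<lambda>\<xi>. \<chi>int \<xi> *\<^sub>R W t \<xi> - \<chi>int \<xi> *\<^sub>R (T \<xi> *v (if norm \<xi> \<le> \<epsilon> then V t \<xi> else 0))) = ?d"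
      using supp0 by fastforce
    finally have d: "?d \<in> borel_measurable lborel" .
    show "in_Hdot_hat s0 ?d \<and> Hdot_norm_hat s0 ?d \<le>
        C * ((1 + t) powr (- ((real CARD('n) + 2 * (s0 + \<kappa>)) / (2 * m)) - k / m) * weighted_L1_norm \<kappa> w0
           + (1 + t) powr (- ((real CARD('n) + 2 * s0) / (2 * m)) - k / m) * norm (mean w0))"
    proof (rule decay[OF d _ _ t])
      show "weighted_L1_norm \<kappa> w0 \<ge> 0"
        unfolding weighted_L1_norm_def by (intro integral_nonneg_AE) auto
      fix \<xi> :: "real^'n" assume \<xi>: "\<xi> \<noteq> 0"
      define B where "B = norm \<xi> powr \<kappa> * weighted_L1_norm \<kappa> w0 + norm (mean w0)"
      define E where "E = norm \<xi> powr k * exp (- c * norm \<xi> powr m * t)"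
      have E: "E \<ge> 0" by (simp add: E_def)
      have B: "norm (fourier w0 \<xi>) \<le> 2 * B"
        unfolding B_def by (rule fourier_low_frequency_bound[OF int w0 \<kappa>])
      show "norm (?d \<xi>) \<le> (X' * K * 2) * (indicator (cball 0 1) \<xi> * norm \<xi> powr k * exp (- c * norm \<xi> powr m * t))
           * (norm \<xi> powr \<kappa> * weighted_L1_norm \<kappa> w0 + norm (mean w0))"
      proof (cases "norm \<xi> \<le> \<epsilon>")
        case True
        have "norm (?d \<xi>) = \<bar>\<chi>int \<xi>\<bar> * norm (W t \<xi> - T \<xi> *v V t \<xi>)"
          by (simp add: scaleR_diff_right[symmetric])
        also have "\<dots> \<le> X' * (K * E * (2 * B))"
        proof (intro mult_mono)
          show "\<bar>\<chi>int \<xi>\<bar> \<le> X'" using X[OF True] by (simp add: X'_def)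
          have "norm (W t \<xi> - T \<xi> *v V t \<xi>) \<le> K * E * norm (fourier w0 \<xi>)"
            using bound[OF \<xi> True] by (simp add: E_def mult_ac)
          also have "\<dots> \<le> K * E * (2 * B)" using K E B by (intro mult_left_mono) auto
          finally show "norm (W t \<xi> - T \<xi> *v V t \<xi>) \<le> K * E * (2 * B)" .
        qed (auto simp: X'_def)
        finally show ?thesis using True \<epsilon> unfolding B_def[symmetric] by (simp add: E_def mult_ac)
      next
        case False
        then have "\<chi>int \<xi> = 0" using supp0 by blast
        moreover have "B \<ge> 0" using B norm_ge_zero[of "fourier w0 \<xi>"] by linarith
        ultimately show ?thesis using E K unfolding B_def[symmetric] by (simp add: X'_def)
      qed
    qed auto
  qed
qed

section \<open>The two regimes\<close>

lemma small_frequency_threshold: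
  fixes q k :: real
  assumes "0 < q" "k > 0"
  obtains \<epsilon>0 where "0 < \<epsilon>0" "\<epsilon>0 \<le> 1" "\<And>r. 0 \<le> r \<Longrightarrow> r \<le> \<epsilon>0 \<Longrightarrow> r powr k \<le> q"
proof
  show "0 < min 1 (q powr (1 / k))" "min 1 (q powr (1 / k)) \<le> 1" using assms by auto
  fix r :: real assume "0 \<le> r" "r \<le> min 1 (q powr (1 / k))"
  then have "r powr k \<le> (q powr (1 / k)) powr k" using assms by (intro powr_mono2) auto
  also have "\<dots> = q" using assms by (simp add: powr_powr)
  finally show "r powr k \<le> q" .
qed

lemma borel_measurable_frac_lap_symbol [measurable]:
  "frac_lap_symbol \<nu> \<in> borel_measurable lborel"
  unfolding frac_lap_symbol_def[abs_def] by measurable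

lemma invertible_mat1: "invertible (mat 1 :: complex^3^3)"
  unfolding invertible_def by (metis matrix_mul_lid)

text \<open>With \<open>\<delta> = r powr k\<close> and \<open>a = r powr (2 \<sigma> \<alpha>)\<close> the decay rate \<open>a \<delta>\<^sup>2\<close> is \<open>r powr m\<close>, and the
  gain \<open>k / m\<close> is \<open>(1 - 2 \<alpha>) / (2 (1 - \<alpha>))\<close>.\<close>

lemma first_profile_decay:
  fixes \<sigma> \<alpha> :: real
  assumes \<sigma>: "\<sigma> \<ge> 1" and \<alpha>: "\<alpha> < 1/2"
  shows "\<exists>\<epsilon>0>0. \<forall>\<epsilon> (\<chi>int :: real^'n \<Rightarrow> real) \<kappa> s0. \<epsilon> \<le> \<epsilon>0 \<longrightarrow> continuous_on UNIV \<chi>int \<longrightarrow>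
    fn_support \<chi>int \<subseteq> {\<xi>. norm \<xi> \<le> \<epsilon>} \<longrightarrow> 0 \<le> \<kappa> \<longrightarrow> \<kappa> \<le> 1 \<longrightarrow> 0 \<le> s0 \<longrightarrow>
    (\<exists>C>0. \<forall>w0. integrable lborel w0 \<longrightarrow> w0 \<in> weighted_L1 \<kappa> \<longrightarrow> (\<forall>w_hat wtilde_hat.
      main_solution \<sigma> \<alpha> w0 w_hat \<longrightarrow> first_reference \<sigma> \<alpha> w0 wtilde_hat \<longrightarrow>
      (\<forall>t\<ge>0.
        in_Hdot_hat s0 (\<lambda>\<xi>. \<chi>int \<xi> *\<^sub>R w_hat t \<xi> - S_int_hat \<sigma> \<alpha> \<chi>int wtilde_hat t \<xi>) \<and>
        Hdot_norm_hat s0 (\<lambda>\<xi>. \<chi>int \<xi> *\<^sub>R w_hat t \<xi> - S_int_hat \<sigma> \<alpha> \<chi>int wtilde_hat t \<xi>)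
        \<le> C * ((1 + t) powr (- ((real CARD('n) + 2 * (s0 + \<kappa>)) / (2 * (2 * \<sigma> - 2 * \<sigma> * \<alpha>)))
                             - (1 - 2 * \<alpha>) / (2 * (1 - \<alpha>))) * weighted_L1_norm \<kappa> w0
             + (1 + t) powr (- ((real CARD('n) + 2 * s0) / (2 * (2 * \<sigma> - 2 * \<sigma> * \<alpha>)))
                             - (1 - 2 * \<alpha>) / (2 * (1 - \<alpha>))) * norm (mean w0)))))"
proof -
  define k m where "k = \<sigma> - 2 * \<sigma> * \<alpha>" and "m = 2 * \<sigma> - 2 * \<sigma> * \<alpha>"
  have "\<sigma> * \<alpha> < \<sigma> * (1 / 2)" using \<sigma> \<alpha> by (intro mult_strict_left_mono) auto
  then have km: "k > 0" "m > 0" using \<sigma> by (auto simp: k_def m_def)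
  have km_eq: "(1 - 2 * \<alpha>) / (2 * (1 - \<alpha>)) = k / m"
    using \<sigma> \<alpha> by (simp add: k_def m_def divide_simps) (simp add: algebra_simps)
  obtain q0 K where q0: "0 < q0" "q0 \<le> 1" and K: "K > 0"
    and inv: "\<And>\<delta>. 0 < \<delta> \<Longrightarrow> \<delta> \<le> q0 \<Longrightarrow> invertible (mat 1 + \<delta> *\<^sub>R N2_coeff)"
    and est: "\<And>a \<delta> w v t. 0 < a \<Longrightarrow> 0 < \<delta> \<Longrightarrow> \<delta> \<le> q0 \<Longrightarrow>
      (\<And>t. t \<ge> 0 \<Longrightarrow> (w has_vector_derivative (a *\<^sub>R (B1 + \<delta> *\<^sub>R B0)) *v w t) (at t within {0..})) \<Longrightarrow>
      (\<And>t. t \<ge> 0 \<Longrightarrow> (v has_vector_derivative (a *\<^sub>R (first_diag0 + \<delta>\<^sup>2 *\<^sub>R first_diag2)) *v v t) (at t within {0..})) \<Longrightarrow>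
      (N1 ** (mat 1 + \<delta> *\<^sub>R N2_coeff)) *v v 0 = w 0 \<Longrightarrow> t \<ge> 0 \<Longrightarrow>
      norm (w t - (N1 ** (mat 1 + \<delta> *\<^sub>R N2_coeff)) *v v t) \<le> K * \<delta> * exp (- (a * \<delta>\<^sup>2 / 8) * t) * norm (w 0)"
    by (fact first_profile_error)
  obtain \<epsilon>0 where \<epsilon>0: "0 < \<epsilon>0" "\<epsilon>0 \<le> 1" "\<And>r. 0 \<le> r \<Longrightarrow> r \<le> \<epsilon>0 \<Longrightarrow> r powr k \<le> q0"
    using small_frequency_threshold[OF q0(1) km(1)] by metis
  show ?thesis
  proof (rule exI[of _ \<epsilon>0], intro conjI \<epsilon>0 allI impI)
    fix \<epsilon> \<kappa> s0 :: real and \<chi>int :: "real^'n \<Rightarrow> real"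
    assume \<epsilon>: "\<epsilon> \<le> \<epsilon>0" and \<chi>int: "continuous_on UNIV \<chi>int" "fn_support \<chi>int \<subseteq> {\<xi>. norm \<xi> \<le> \<epsilon>}"
      and \<kappa>: "0 \<le> \<kappa>" "\<kappa> \<le> 1" and s0: "0 \<le> s0"
    have "\<epsilon> \<le> 1" using \<epsilon> \<epsilon>0 by simp
    from low_frequency_profile_estimate[of "1 / 8" m k s0 \<kappa> K, OF _ km(2) less_imp_le[OF km(1)] s0 \<kappa> less_imp_le[OF K] this \<chi>int]
    obtain C where C: "C > 0" and decay:
      "\<And>w0 A D T g W V t. integrable lborel w0 \<Longrightarrow> w0 \<in> weighted_L1 \<kappa> \<Longrightarrow>
      fourier_solution A (fourier w0) W \<Longrightarrow> fourier_solution D g V \<Longrightarrow>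
      A \<in> borel_measurable lborel \<Longrightarrow> D \<in> borel_measurable lborel \<Longrightarrow> T \<in> borel_measurable lborel \<Longrightarrow>
      (\<lambda>\<xi>. if norm \<xi> \<le> \<epsilon> then g \<xi> else 0) \<in> borel_measurable lborel \<Longrightarrow> t \<ge> 0 \<Longrightarrow>
      (\<And>\<xi>. \<xi> \<noteq> 0 \<Longrightarrow> norm \<xi> \<le> \<epsilon> \<Longrightarrow> norm (W t \<xi> - T \<xi> *v V t \<xi>)
         \<le> K * norm \<xi> powr k * exp (- (1 / 8) * norm \<xi> powr m * t) * norm (fourier w0 \<xi>)) \<Longrightarrow>
      in_Hdot_hat s0 (\<lambda>\<xi>. \<chi>int \<xi> *\<^sub>R W t \<xi> - \<chi>int \<xi> *\<^sub>R (T \<xi> *v V t \<xi>)) \<and>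
      Hdot_norm_hat s0 (\<lambda>\<xi>. \<chi>int \<xi> *\<^sub>R W t \<xi> - \<chi>int \<xi> *\<^sub>R (T \<xi> *v V t \<xi>))
        \<le> C * ((1 + t) powr (- ((real CARD('n) + 2 * (s0 + \<kappa>)) / (2 * m)) - k / m) * weighted_L1_norm \<kappa> w0
           + (1 + t) powr (- ((real CARD('n) + 2 * s0) / (2 * m)) - k / m) * norm (mean w0))"
      by auto
    have inv_N2: "invertible (mat 1 + N2 \<sigma> \<alpha> (norm \<xi>))" if "norm \<xi> \<le> \<epsilon>" for \<xi> :: "real^'n"
    proof (cases "\<xi> = 0")
      case True
      then show ?thesis by (simp add: N2_eq invertible_mat1)
    next
      case False
      then show ?thesis using inv[of "norm \<xi> powr k"] \<epsilon>0(3)[of "norm \<xi>"] that \<epsilon> by (simp add: N2_eq k_def)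
    qed
    show "\<exists>C>0. \<forall>w0. integrable lborel w0 \<longrightarrow> w0 \<in> weighted_L1 \<kappa> \<longrightarrow> (\<forall>w_hat wtilde_hat.
      main_solution \<sigma> \<alpha> w0 w_hat \<longrightarrow> first_reference \<sigma> \<alpha> w0 wtilde_hat \<longrightarrow>
      (\<forall>t\<ge>0.
        in_Hdot_hat s0 (\<lambda>\<xi>. \<chi>int \<xi> *\<^sub>R w_hat t \<xi> - S_int_hat \<sigma> \<alpha> \<chi>int wtilde_hat t \<xi>) \<and>
        Hdot_norm_hat s0 (\<lambda>\<xi>. \<chi>int \<xi> *\<^sub>R w_hat t \<xi> - S_int_hat \<sigma> \<alpha> \<chi>int wtilde_hat t \<xi>)
        \<le> C * ((1 + t) powr (- ((real CARD('n) + 2 * (s0 + \<kappa>)) / (2 * (2 * \<sigma> - 2 * \<sigma> * \<alpha>)))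
                             - (1 - 2 * \<alpha>) / (2 * (1 - \<alpha>))) * weighted_L1_norm \<kappa> w0
             + (1 + t) powr (- ((real CARD('n) + 2 * s0) / (2 * (2 * \<sigma> - 2 * \<sigma> * \<alpha>)))
                             - (1 - 2 * \<alpha>) / (2 * (1 - \<alpha>))) * norm (mean w0))))"
      unfolding km_eq m_def[symmetric] S_int_hat_def
    proof (intro exI[of _ C] conjI[OF C] allI impI)
      fix w0 :: "real^'n \<Rightarrow> complex^3" and W V :: "real \<Rightarrow> real^'n \<Rightarrow> complex^3" and t :: real
      assume int: "integrable lborel w0" and w0: "w0 \<in> weighted_L1 \<kappa>"
        and W: "main_solution \<sigma> \<alpha> w0 W" and V: "first_reference \<sigma> \<alpha> w0 V" and t: "t \<ge> 0"
      note W = W[unfolded main_solution_def] and V = V[unfolded first_reference_def]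
      have [measurable]: "fourier w0 \<in> borel_measurable lborel" by (rule borel_measurable_fourier[OF int])
      show "in_Hdot_hat s0 (\<lambda>\<xi>. \<chi>int \<xi> *\<^sub>R W t \<xi> - \<chi>int \<xi> *\<^sub>R ((N1 ** (mat 1 + N2 \<sigma> \<alpha> (norm \<xi>))) *v V t \<xi>)) \<and>
        Hdot_norm_hat s0 (\<lambda>\<xi>. \<chi>int \<xi> *\<^sub>R W t \<xi> - \<chi>int \<xi> *\<^sub>R ((N1 ** (mat 1 + N2 \<sigma> \<alpha> (norm \<xi>))) *v V t \<xi>))
        \<le> C * ((1 + t) powr (- ((real CARD('n) + 2 * (s0 + \<kappa>)) / (2 * m)) - k / m) * weighted_L1_norm \<kappa> w0
           + (1 + t) powr (- ((real CARD('n) + 2 * s0) / (2 * m)) - k / m) * norm (mean w0))"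
      proof (rule decay[OF int w0 W V _ _ _ _ t])
        show "(\<lambda>\<xi>. if norm \<xi> \<le> \<epsilon> then matrix_inv (mat 1 + N2 \<sigma> \<alpha> (norm \<xi>)) *v (matrix_inv N1 *v fourier w0 \<xi>) else 0)
            \<in> borel_measurable lborel"
          by (rule borel_measurable_matrix_inv_vector[OF _ _ _ inv_N2]) (unfold N2_eq, measurable)
      next
        fix \<xi> :: "real^'n" assume \<xi>: "\<xi> \<noteq> 0" "norm \<xi> \<le> \<epsilon>"
        define r where "r = norm \<xi>"
        define a where "a = r powr (2 * \<sigma> * \<alpha>)"
        define \<delta> where "\<delta> = r powr k"
        have r: "r > 0" "r \<le> \<epsilon>" using \<xi> by (auto simp: r_def)
        have a: "a > 0" and \<delta>: "\<delta> > 0" "\<delta> \<le> q0" using r \<epsilon> \<epsilon>0 by (auto simp: a_def \<delta>_def)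
        have ad: "a * \<delta> = r powr \<sigma>" by (simp add: a_def \<delta>_def k_def powr_add[symmetric])
        have "2 * \<sigma> * \<alpha> + (k + k) = m" by (simp add: k_def m_def)
        then have ad2: "a * \<delta>\<^sup>2 = r powr m"
          by (simp add: a_def \<delta>_def power2_eq_square powr_add[symmetric])
        have N2: "N2 \<sigma> \<alpha> (norm \<xi>) = \<delta> *\<^sub>R N2_coeff" by (simp add: N2_eq \<delta>_def r_def k_def)
        have "norm (W t \<xi> - (N1 ** (mat 1 + \<delta> *\<^sub>R N2_coeff)) *v V t \<xi>)
            \<le> K * \<delta> * exp (- (a * \<delta>\<^sup>2 / 8) * t) * norm (W 0 \<xi>)"
        proof (rule est[OF a \<delta> _ _ _ t])
          have "frac_lap_symbol (\<sigma> / 2) \<xi> *\<^sub>R B0 + frac_lap_symbol (\<sigma> * \<alpha>) \<xi> *\<^sub>R B1 = a *\<^sub>R (B1 + \<delta> *\<^sub>R B0)"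
            by (simp add: frac_lap_symbol_def scaleR_add_right ad r_def[symmetric] a_def[symmetric] mult.assoc[symmetric])
          then show "((\<lambda>\<tau>. W \<tau> \<xi>) has_vector_derivative (a *\<^sub>R (B1 + \<delta> *\<^sub>R B0)) *v W s \<xi>) (at s within {0..})" if "s \<ge> 0" for s
            using W that unfolding fourier_solution_def by metis
          have "- (frac_lap_symbol (\<sigma> * \<alpha>) \<xi> *\<^sub>R diag3 0 (1/2 + \<i> * rt3 / 2) (1/2 - \<i> * rt3 / 2)
              + frac_lap_symbol (\<sigma> - \<sigma> * \<alpha>) \<xi> *\<^sub>R diag3 1 (- 1/2 + \<i> * rt3 / 6) (- 1/2 - \<i> * rt3 / 6))
            = a *\<^sub>R (first_diag0 + \<delta>\<^sup>2 *\<^sub>R first_diag2)"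
          proof -
            have "frac_lap_symbol (\<sigma> * \<alpha>) \<xi> = a" by (simp add: frac_lap_symbol_def a_def r_def mult.assoc)
            moreover have "frac_lap_symbol (\<sigma> - \<sigma> * \<alpha>) \<xi> = a * \<delta>\<^sup>2"
            proof -
              have "2 * (\<sigma> - \<sigma> * \<alpha>) = m" by (simp add: m_def)
              then show ?thesis unfolding ad2 by (simp only: frac_lap_symbol_def r_def)
            qed
            moreover have "- diag3 x y z = diag3 (- x) (- y) (- z)" for x y z
              by (simp add: mat3_entries)
            ultimately show ?thesis
              unfolding diag3_scale diag3_plus by (simp only: diag3_scale) (simp add: algebra_simps scaleR_conv_of_real)
          qed
          then show "((\<lambda>\<tau>. V \<tau> \<xi>) has_vector_derivative (a *\<^sub>R (first_diag0 + \<delta>\<^sup>2 *\<^sub>R first_diag2)) *v V s \<xi>) (at s within {0..})"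
            if "s \<ge> 0" for s
            using V that unfolding fourier_solution_def by metis
          show "(N1 ** (mat 1 + \<delta> *\<^sub>R N2_coeff)) *v V 0 \<xi> = W 0 \<xi>"
            using V W matrix_inv_mult_vec(1)[OF inv_N2[OF \<xi>(2)]] matrix_inv_mult_vec(1)[OF N1_invertible]
            by (simp add: fourier_solution_def N2 matrix_vector_mul_assoc[symmetric])
        qed
        then show "norm (W t \<xi> - (N1 ** (mat 1 + N2 \<sigma> \<alpha> (norm \<xi>))) *v V t \<xi>)
            \<le> K * norm \<xi> powr k * exp (- (1 / 8) * norm \<xi> powr m * t) * norm (fourier w0 \<xi>)"
          using W unfolding N2 ad2 by (simp add: fourier_solution_def \<delta>_def r_def)
      qed (unfold N2_eq, measurable)
    qed
  qed
qed

text \<open>With \<open>\<delta> = r powr k\<close> and \<open>a = r powr \<sigma>\<close> the decay rate \<open>a \<delta>\<^sup>3\<close> is \<open>r powr m\<close>, and the gain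
  \<open>k / m\<close> is \<open>(2 \<alpha> - 1) / (2 (3 \<alpha> - 1))\<close>.\<close>

lemma second_profile_decay:
  fixes \<sigma> \<alpha> :: real
  assumes \<sigma>: "\<sigma> \<ge> 1" and \<alpha>: "\<alpha> > 1/2"
  shows "\<exists>\<epsilon>0>0. \<forall>\<epsilon> (\<chi>int :: real^'n \<Rightarrow> real) \<kappa> s0. \<epsilon> \<le> \<epsilon>0 \<longrightarrow> continuous_on UNIV \<chi>int \<longrightarrow>
    fn_support \<chi>int \<subseteq> {\<xi>. norm \<xi> \<le> \<epsilon>} \<longrightarrow> 0 \<le> \<kappa> \<longrightarrow> \<kappa> \<le> 1 \<longrightarrow> 0 \<le> s0 \<longrightarrow>
    (\<exists>C>0. \<forall>w0. integrable lborel w0 \<longrightarrow> w0 \<in> weighted_L1 \<kappa> \<longrightarrow> (\<forall>w_hat wbar_hat.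
      main_solution \<sigma> \<alpha> w0 w_hat \<longrightarrow> second_reference \<sigma> \<alpha> w0 wbar_hat \<longrightarrow>
      (\<forall>t\<ge>0.
        in_Hdot_hat s0 (\<lambda>\<xi>. \<chi>int \<xi> *\<^sub>R w_hat t \<xi> - S_int_tilde_hat \<sigma> \<alpha> \<chi>int wbar_hat t \<xi>) \<and>
        Hdot_norm_hat s0 (\<lambda>\<xi>. \<chi>int \<xi> *\<^sub>R w_hat t \<xi> - S_int_tilde_hat \<sigma> \<alpha> \<chi>int wbar_hat t \<xi>)
        \<le> C * ((1 + t) powr (- ((real CARD('n) + 2 * (s0 + \<kappa>)) / (2 * (6 * \<sigma> * \<alpha> - 2 * \<sigma>)))
                             - (2 * \<alpha> - 1) / (2 * (3 * \<alpha> - 1))) * weighted_L1_norm \<kappa> w0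
             + (1 + t) powr (- ((real CARD('n) + 2 * s0) / (2 * (6 * \<sigma> * \<alpha> - 2 * \<sigma>)))
                             - (2 * \<alpha> - 1) / (2 * (3 * \<alpha> - 1))) * norm (mean w0)))))"
proof -
  define k m where "k = 2 * \<sigma> * \<alpha> - \<sigma>" and "m = 6 * \<sigma> * \<alpha> - 2 * \<sigma>"
  have "\<sigma> * \<alpha> > \<sigma> * (1 / 2)" using \<sigma> \<alpha> by (intro mult_strict_left_mono) auto
  then have km: "k > 0" "m > 0" using \<sigma> by (auto simp: k_def m_def)
  have km_eq: "(2 * \<alpha> - 1) / (2 * (3 * \<alpha> - 1)) = k / m"
  proof -
    have "k = \<sigma> * (2 * \<alpha> - 1)" "m = \<sigma> * (2 * (3 * \<alpha> - 1))" by (simp_all add: k_def m_def algebra_simps)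
    then show ?thesis using \<sigma> by (simp only: mult_divide_mult_cancel_left)
  qed
  obtain q0 K where q0: "0 < q0" "q0 \<le> 1" and K: "K > 0"
    and inv: "\<And>\<delta>. 0 < \<delta> \<Longrightarrow> \<delta> \<le> q0 \<Longrightarrow> invertible (mat 1 + \<delta> *\<^sub>R N4_coeff)"
      "\<And>\<delta>. 0 < \<delta> \<Longrightarrow> \<delta> \<le> q0 \<Longrightarrow> invertible (mat 1 + \<delta>\<^sup>2 *\<^sub>R N5_coeff)"
    and est: "\<And>a \<delta> w v t. 0 < a \<Longrightarrow> 0 < \<delta> \<Longrightarrow> \<delta> \<le> q0 \<Longrightarrow>
      (\<And>t. t \<ge> 0 \<Longrightarrow> (w has_vector_derivative (a *\<^sub>R (B0 + \<delta> *\<^sub>R B1)) *v w t) (at t within {0..})) \<Longrightarrow>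
      (\<And>t. t \<ge> 0 \<Longrightarrow> (v has_vector_derivative
          (a *\<^sub>R (B0 + \<delta> *\<^sub>R second_diag1 + \<delta>\<^sup>2 *\<^sub>R second_diag2 + \<delta> ^ 3 *\<^sub>R second_diag3)) *v v t) (at t within {0..})) \<Longrightarrow>
      ((mat 1 + \<delta> *\<^sub>R N4_coeff) ** (mat 1 + \<delta>\<^sup>2 *\<^sub>R N5_coeff)) *v v 0 = w 0 \<Longrightarrow> t \<ge> 0 \<Longrightarrow>
      norm (w t - ((mat 1 + \<delta> *\<^sub>R N4_coeff) ** (mat 1 + \<delta>\<^sup>2 *\<^sub>R N5_coeff)) *v v t)
        \<le> K * \<delta> * exp (- (a * \<delta> ^ 3 / 8) * t) * norm (w 0)"
    by (fact second_profile_error)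
  obtain \<epsilon>0 where \<epsilon>0: "0 < \<epsilon>0" "\<epsilon>0 \<le> 1" "\<And>r. 0 \<le> r \<Longrightarrow> r \<le> \<epsilon>0 \<Longrightarrow> r powr k \<le> q0"
    using small_frequency_threshold[OF q0(1) km(1)] by metis
  show ?thesis
  proof (rule exI[of _ \<epsilon>0], intro conjI \<epsilon>0 allI impI)
    fix \<epsilon> \<kappa> s0 :: real and \<chi>int :: "real^'n \<Rightarrow> real"
    assume \<epsilon>: "\<epsilon> \<le> \<epsilon>0" and \<chi>int: "continuous_on UNIV \<chi>int" "fn_support \<chi>int \<subseteq> {\<xi>. norm \<xi> \<le> \<epsilon>}"
      and \<kappa>: "0 \<le> \<kappa>" "\<kappa> \<le> 1" and s0: "0 \<le> s0"
    have "\<epsilon> \<le> 1" using \<epsilon> \<epsilon>0 by simp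
    from low_frequency_profile_estimate[of "1 / 8" m k s0 \<kappa> K, OF _ km(2) less_imp_le[OF km(1)] s0 \<kappa> less_imp_le[OF K] this \<chi>int]
    obtain C where C: "C > 0" and decay:
      "\<And>w0 A D T g W V t. integrable lborel w0 \<Longrightarrow> w0 \<in> weighted_L1 \<kappa> \<Longrightarrow>
      fourier_solution A (fourier w0) W \<Longrightarrow> fourier_solution D g V \<Longrightarrow>
      A \<in> borel_measurable lborel \<Longrightarrow> D \<in> borel_measurable lborel \<Longrightarrow> T \<in> borel_measurable lborel \<Longrightarrow>
      (\<lambda>\<xi>. if norm \<xi> \<le> \<epsilon> then g \<xi> else 0) \<in> borel_measurable lborel \<Longrightarrow> t \<ge> 0 \<Longrightarrow>
      (\<And>\<xi>. \<xi> \<noteq> 0 \<Longrightarrow> norm \<xi> \<le> \<epsilon> \<Longrightarrow> norm (W t \<xi> - T \<xi> *v V t \<xi>)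
         \<le> K * norm \<xi> powr k * exp (- (1 / 8) * norm \<xi> powr m * t) * norm (fourier w0 \<xi>)) \<Longrightarrow>
      in_Hdot_hat s0 (\<lambda>\<xi>. \<chi>int \<xi> *\<^sub>R W t \<xi> - \<chi>int \<xi> *\<^sub>R (T \<xi> *v V t \<xi>)) \<and>
      Hdot_norm_hat s0 (\<lambda>\<xi>. \<chi>int \<xi> *\<^sub>R W t \<xi> - \<chi>int \<xi> *\<^sub>R (T \<xi> *v V t \<xi>))
        \<le> C * ((1 + t) powr (- ((real CARD('n) + 2 * (s0 + \<kappa>)) / (2 * m)) - k / m) * weighted_L1_norm \<kappa> w0
           + (1 + t) powr (- ((real CARD('n) + 2 * s0) / (2 * m)) - k / m) * norm (mean w0))"
      by auto
    have inv_N: "invertible (mat 1 + N4 \<sigma> \<alpha> (norm \<xi>))" "invertible (mat 1 + N5 \<sigma> \<alpha> (norm \<xi>))"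
      if "norm \<xi> \<le> \<epsilon>" for \<xi> :: "real^'n"
    proof -
      show "invertible (mat 1 + N4 \<sigma> \<alpha> (norm \<xi>))"
      proof (cases "\<xi> = 0")
        case False
        then show ?thesis using inv(1)[of "norm \<xi> powr k"] \<epsilon>0(3)[of "norm \<xi>"] that \<epsilon> by (simp add: N4_eq k_def)
      qed (simp add: N4_eq invertible_mat1)
      show "invertible (mat 1 + N5 \<sigma> \<alpha> (norm \<xi>))"
      proof (cases "\<xi> = 0")
        case False
        then show ?thesis using inv(2)[of "norm \<xi> powr k"] \<epsilon>0(3)[of "norm \<xi>"] that \<epsilon> by (simp add: N5_eq k_def)
      qed (simp add: N5_eq invertible_mat1)
    qed
    show "\<exists>C>0. \<forall>w0. integrable lborel w0 \<longrightarrow> w0 \<in> weighted_L1 \<kappa> \<longrightarrow> (\<forall>w_hat wbar_hat.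
      main_solution \<sigma> \<alpha> w0 w_hat \<longrightarrow> second_reference \<sigma> \<alpha> w0 wbar_hat \<longrightarrow>
      (\<forall>t\<ge>0.
        in_Hdot_hat s0 (\<lambda>\<xi>. \<chi>int \<xi> *\<^sub>R w_hat t \<xi> - S_int_tilde_hat \<sigma> \<alpha> \<chi>int wbar_hat t \<xi>) \<and>
        Hdot_norm_hat s0 (\<lambda>\<xi>. \<chi>int \<xi> *\<^sub>R w_hat t \<xi> - S_int_tilde_hat \<sigma> \<alpha> \<chi>int wbar_hat t \<xi>)
        \<le> C * ((1 + t) powr (- ((real CARD('n) + 2 * (s0 + \<kappa>)) / (2 * (6 * \<sigma> * \<alpha> - 2 * \<sigma>)))
                             - (2 * \<alpha> - 1) / (2 * (3 * \<alpha> - 1))) * weighted_L1_norm \<kappa> w0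
             + (1 + t) powr (- ((real CARD('n) + 2 * s0) / (2 * (6 * \<sigma> * \<alpha> - 2 * \<sigma>)))
                             - (2 * \<alpha> - 1) / (2 * (3 * \<alpha> - 1))) * norm (mean w0))))"
      unfolding km_eq m_def[symmetric] S_int_tilde_hat_def
    proof (intro exI[of _ C] conjI[OF C] allI impI)
      fix w0 :: "real^'n \<Rightarrow> complex^3" and W V :: "real \<Rightarrow> real^'n \<Rightarrow> complex^3" and t :: real
      assume int: "integrable lborel w0" and w0: "w0 \<in> weighted_L1 \<kappa>"
        and W: "main_solution \<sigma> \<alpha> w0 W" and V: "second_reference \<sigma> \<alpha> w0 V" and t: "t \<ge> 0"
      note W = W[unfolded main_solution_def] and V = V[unfolded second_reference_def]
      have [measurable]: "fourier w0 \<in> borel_measurable lborel" by (rule borel_measurable_fourier[OF int])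
      show "in_Hdot_hat s0 (\<lambda>\<xi>. \<chi>int \<xi> *\<^sub>R W t \<xi> - \<chi>int \<xi> *\<^sub>R (((mat 1 + N4 \<sigma> \<alpha> (norm \<xi>)) ** (mat 1 + N5 \<sigma> \<alpha> (norm \<xi>))) *v V t \<xi>)) \<and>
        Hdot_norm_hat s0 (\<lambda>\<xi>. \<chi>int \<xi> *\<^sub>R W t \<xi> - \<chi>int \<xi> *\<^sub>R (((mat 1 + N4 \<sigma> \<alpha> (norm \<xi>)) ** (mat 1 + N5 \<sigma> \<alpha> (norm \<xi>))) *v V t \<xi>))
        \<le> C * ((1 + t) powr (- ((real CARD('n) + 2 * (s0 + \<kappa>)) / (2 * m)) - k / m) * weighted_L1_norm \<kappa> w0
           + (1 + t) powr (- ((real CARD('n) + 2 * s0) / (2 * m)) - k / m) * norm (mean w0))"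
      proof (rule decay[OF int w0 W V _ _ _ _ t])
        let ?h = "\<lambda>\<xi>. if norm \<xi> \<le> \<epsilon> then matrix_inv (mat 1 + N4 \<sigma> \<alpha> (norm \<xi>)) *v fourier w0 \<xi> else 0"
        have h: "?h \<in> borel_measurable lborel"
          by (rule borel_measurable_matrix_inv_vector[OF _ _ _ inv_N(1)]) (unfold N4_eq, measurable)
        have "(\<lambda>\<xi>. if norm \<xi> \<le> \<epsilon> then matrix_inv (mat 1 + N5 \<sigma> \<alpha> (norm \<xi>)) *v ?h \<xi> else 0) \<in> borel_measurable lborel"
          by (rule borel_measurable_matrix_inv_vector[OF _ h _ inv_N(2)]) (unfold N5_eq, measurable)
        then show "(\<lambda>\<xi>. if norm \<xi> \<le> \<epsilon> then matrix_inv (mat 1 + N5 \<sigma> \<alpha> (norm \<xi>)) *v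
            (matrix_inv (mat 1 + N4 \<sigma> \<alpha> (norm \<xi>)) *v fourier w0 \<xi>) else 0) \<in> borel_measurable lborel"
          by (simp cong: if_cong)
      next
        fix \<xi> :: "real^'n" assume \<xi>: "\<xi> \<noteq> 0" "norm \<xi> \<le> \<epsilon>"
        define r where "r = norm \<xi>"
        define a where "a = r powr \<sigma>"
        define \<delta> where "\<delta> = r powr k"
        have r: "r > 0" "r \<le> \<epsilon>" using \<xi> by (auto simp: r_def)
        have a: "a > 0" and \<delta>: "\<delta> > 0" "\<delta> \<le> q0" using r \<epsilon> \<epsilon>0 by (auto simp: a_def \<delta>_def)
        have ad: "a * \<delta> = r powr (2 * \<sigma> * \<alpha>)" by (simp add: a_def \<delta>_def k_def powr_add[symmetric])
        have "\<sigma> + k + k = 4 * \<sigma> * \<alpha> - \<sigma>" "\<sigma> + k + k + k = m" by (simp_all add: k_def m_def)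
        moreover have "a * \<delta>\<^sup>2 = r powr (\<sigma> + k + k)" "a * \<delta> ^ 3 = r powr (\<sigma> + k + k + k)"
          by (simp_all only: a_def \<delta>_def power2_eq_square power3_eq_cube powr_add mult.assoc)
        ultimately have ad2: "a * \<delta>\<^sup>2 = r powr (4 * \<sigma> * \<alpha> - \<sigma>)" and ad3: "a * \<delta> ^ 3 = r powr m"
          by metis+
        have N4: "N4 \<sigma> \<alpha> (norm \<xi>) = \<delta> *\<^sub>R N4_coeff" by (simp add: N4_eq \<delta>_def r_def k_def)
        have N5: "N5 \<sigma> \<alpha> (norm \<xi>) = \<delta>\<^sup>2 *\<^sub>R N5_coeff" by (simp add: N5_eq \<delta>_def r_def k_def)
        have "norm (W t \<xi> - ((mat 1 + \<delta> *\<^sub>R N4_coeff) ** (mat 1 + \<delta>\<^sup>2 *\<^sub>R N5_coeff)) *v V t \<xi>)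
            \<le> K * \<delta> * exp (- (a * \<delta> ^ 3 / 8) * t) * norm (W 0 \<xi>)"
        proof (rule est[OF a \<delta> _ _ _ t])
          have f1: "frac_lap_symbol (\<sigma> / 2) \<xi> = a" "frac_lap_symbol (\<sigma> * \<alpha>) \<xi> = a * \<delta>"
            by (simp_all add: frac_lap_symbol_def ad) (simp_all add: a_def r_def mult.assoc)
          have f2: "frac_lap_symbol (2 * \<sigma> * \<alpha> - \<sigma> / 2) \<xi> = a * \<delta>\<^sup>2" "frac_lap_symbol (3 * \<sigma> * \<alpha> - \<sigma>) \<xi> = a * \<delta> ^ 3"
          proof -
            have "2 * (2 * \<sigma> * \<alpha> - \<sigma> / 2) = 4 * \<sigma> * \<alpha> - \<sigma>" "2 * (3 * \<sigma> * \<alpha> - \<sigma>) = m"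
              by (simp_all add: m_def)
            then show "frac_lap_symbol (2 * \<sigma> * \<alpha> - \<sigma> / 2) \<xi> = a * \<delta>\<^sup>2" "frac_lap_symbol (3 * \<sigma> * \<alpha> - \<sigma>) \<xi> = a * \<delta> ^ 3"
              unfolding ad2 ad3 by (simp_all only: frac_lap_symbol_def r_def)
          qed
          have "frac_lap_symbol (\<sigma> / 2) \<xi> *\<^sub>R B0 + frac_lap_symbol (\<sigma> * \<alpha>) \<xi> *\<^sub>R B1 = a *\<^sub>R (B0 + \<delta> *\<^sub>R B1)"
            by (simp add: f1 scaleR_add_right)
          then show "((\<lambda>\<tau>. W \<tau> \<xi>) has_vector_derivative (a *\<^sub>R (B0 + \<delta> *\<^sub>R B1)) *v W s \<xi>) (at s within {0..})" if "s \<ge> 0" for s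
            using W that unfolding fourier_solution_def by metis
          have "- diag3 x y z = diag3 (- x) (- y) (- z)" for x y z
            by (simp add: mat3_entries)
          then have "- (frac_lap_symbol (\<sigma> / 2) \<xi> *\<^sub>R diag3 (- \<i>) \<i> 0
              + frac_lap_symbol (\<sigma> * \<alpha>) \<xi> *\<^sub>R diag3 0 0 1
              + frac_lap_symbol (2 * \<sigma> * \<alpha> - \<sigma> / 2) \<xi> *\<^sub>R diag3 (- \<i> / 2) (\<i> / 2) 0
              + frac_lap_symbol (3 * \<sigma> * \<alpha> - \<sigma>) \<xi> *\<^sub>R diag3 (1/2) (1/2) (- 1))
            = a *\<^sub>R (B0 + \<delta> *\<^sub>R second_diag1 + \<delta>\<^sup>2 *\<^sub>R second_diag2 + \<delta> ^ 3 *\<^sub>R second_diag3)"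
            unfolding f1 f2 B0_def diag3_scale diag3_plus
            by (simp add: algebra_simps scaleR_conv_of_real)
          then show "((\<lambda>\<tau>. V \<tau> \<xi>) has_vector_derivative
              (a *\<^sub>R (B0 + \<delta> *\<^sub>R second_diag1 + \<delta>\<^sup>2 *\<^sub>R second_diag2 + \<delta> ^ 3 *\<^sub>R second_diag3)) *v V s \<xi>) (at s within {0..})"
            if "s \<ge> 0" for s
            using V that unfolding fourier_solution_def by metis
          show "((mat 1 + \<delta> *\<^sub>R N4_coeff) ** (mat 1 + \<delta>\<^sup>2 *\<^sub>R N5_coeff)) *v V 0 \<xi> = W 0 \<xi>"
            using V W matrix_inv_mult_vec(1)[OF inv_N(1)[OF \<xi>(2)]] matrix_inv_mult_vec(1)[OF inv_N(2)[OF \<xi>(2)]]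
            by (simp add: fourier_solution_def N4 N5 matrix_vector_mul_assoc[symmetric])
        qed
        then show "norm (W t \<xi> - ((mat 1 + N4 \<sigma> \<alpha> (norm \<xi>)) ** (mat 1 + N5 \<sigma> \<alpha> (norm \<xi>))) *v V t \<xi>)
            \<le> K * norm \<xi> powr k * exp (- (1 / 8) * norm \<xi> powr m * t) * norm (fourier w0 \<xi>)"
          using W unfolding N4 N5 ad3 by (simp add: fourier_solution_def \<delta>_def r_def)
      qed (unfold N4_eq N5_eq, measurable)
    qed
  qed
qed

theorem theorem4p2:
  fixes \<sigma> \<alpha> :: real
  assumes "\<sigma> \<ge> 1"
  shows "\<exists>\<epsilon>0>0. \<forall>\<epsilon> N (\<chi>int :: real^'n \<Rightarrow> real) \<chi>mid \<chi>ext.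
    0 < \<epsilon> \<longrightarrow> \<epsilon> \<le> \<epsilon>0 \<longrightarrow> 1 < N \<longrightarrow> frequency_partition \<epsilon> N \<chi>int \<chi>mid \<chi>ext \<longrightarrow>
    (\<forall>s \<kappa> s0. 0 \<le> s \<longrightarrow> 0 \<le> \<kappa> \<longrightarrow> \<kappa> \<le> 1 \<longrightarrow> 0 \<le> s0 \<longrightarrow> s0 \<le> s \<longrightarrow>
      (1/3 \<le> \<alpha> \<and> \<alpha> < 1/2 \<longrightarrow>
        (\<exists>C>0. \<forall>w0 \<in> sobolev_L1 s \<inter> weighted_L1 \<kappa>. \<forall>w_hat wtilde_hat.
          main_solution \<sigma> \<alpha> w0 w_hat \<longrightarrow> first_reference \<sigma> \<alpha> w0 wtilde_hat \<longrightarrow>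
          (\<forall>t\<ge>0.
            in_Hdot_hat s0 (\<lambda>\<xi>. \<chi>int \<xi> *\<^sub>R w_hat t \<xi> - S_int_hat \<sigma> \<alpha> \<chi>int wtilde_hat t \<xi>) \<and>
            Hdot_norm_hat s0 (\<lambda>\<xi>. \<chi>int \<xi> *\<^sub>R w_hat t \<xi> - S_int_hat \<sigma> \<alpha> \<chi>int wtilde_hat t \<xi>)
            \<le> C * ((1 + t) powr (- ((real CARD('n) + 2 * (s0 + \<kappa>)) / (2 * (2 * \<sigma> - 2 * \<sigma> * \<alpha>)))
                                 - (1 - 2 * \<alpha>) / (2 * (1 - \<alpha>))) * weighted_L1_norm \<kappa> w0
                 + (1 + t) powr (- ((real CARD('n) + 2 * s0) / (2 * (2 * \<sigma> - 2 * \<sigma> * \<alpha>)))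
                                 - (1 - 2 * \<alpha>) / (2 * (1 - \<alpha>))) * norm (mean w0)))))
      \<and>
      (1/2 < \<alpha> \<and> \<alpha> \<le> 1 \<longrightarrow>
        (\<exists>C>0. \<forall>w0 \<in> sobolev_L1 s \<inter> weighted_L1 \<kappa>. \<forall>w_hat wbar_hat.
          main_solution \<sigma> \<alpha> w0 w_hat \<longrightarrow> second_reference \<sigma> \<alpha> w0 wbar_hat \<longrightarrow>
          (\<forall>t\<ge>0.
            in_Hdot_hat s0 (\<lambda>\<xi>. \<chi>int \<xi> *\<^sub>R w_hat t \<xi> - S_int_tilde_hat \<sigma> \<alpha> \<chi>int wbar_hat t \<xi>) \<and>
            Hdot_norm_hat s0 (\<lambda>\<xi>. \<chi>int \<xi> *\<^sub>R w_hat t \<xi> - S_int_tilde_hat \<sigma> \<alpha> \<chi>int wbar_hat t \<xi>)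
            \<le> C * ((1 + t) powr (- ((real CARD('n) + 2 * (s0 + \<kappa>)) / (2 * (6 * \<sigma> * \<alpha> - 2 * \<sigma>)))
                                 - (2 * \<alpha> - 1) / (2 * (3 * \<alpha> - 1))) * weighted_L1_norm \<kappa> w0
                 + (1 + t) powr (- ((real CARD('n) + 2 * s0) / (2 * (6 * \<sigma> * \<alpha> - 2 * \<sigma>)))
                                 - (2 * \<alpha> - 1) / (2 * (3 * \<alpha> - 1))) * norm (mean w0))))))"
proof -
  have smooth_cont: "continuous_on UNIV f" if "smooth f" for f :: "real^'n \<Rightarrow> real"
    using that unfolding smooth_def by (metis C_diff.simps(1))
  have data: "integrable lborel w0" "w0 \<in> weighted_L1 \<kappa>" if "w0 \<in> sobolev_L1 s \<inter> weighted_L1 \<kappa>"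
    for w0 :: "real^'n \<Rightarrow> complex^3" and s \<kappa>
    using that by (auto simp: sobolev_L1_def)
  consider "\<alpha> < 1/2" | "\<alpha> > 1/2" | "\<alpha> = 1/2" by linarith
  then show ?thesis
  proof cases
    case low: 1
    show ?thesis
    proof (rule exE[OF first_profile_decay[OF assms low, where ?'n = 'n]],
        elim conjE, rule exI, rule conjI, assumption, intro allI impI conjI, goal_cases)
      case (1 \<epsilon>0 \<epsilon> N \<chi>int \<chi>mid \<chi>ext s \<kappa> s0)
      have "continuous_on UNIV \<chi>int" "fn_support \<chi>int \<subseteq> {\<xi>. norm \<xi> \<le> \<epsilon>}"
        using 1(6) by (simp_all add: frequency_partition_def smooth_cont)
      note C = 1(2)[rule_format, OF 1(4) this 1(8,9,10)]
      show ?case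
      proof (rule exE[OF C], elim conjE, rule exI, rule conjI, assumption, rule ballI, goal_cases)
        case w0: (1 C w0)
        show ?case by (rule w0(2)[THEN spec, THEN mp, THEN mp, OF data[OF w0(3)]])
      qed
    next
      case 2
      then show ?case using low by simp
    qed
  next
    case high: 2
    show ?thesis
    proof (rule exE[OF second_profile_decay[OF assms high, where ?'n = 'n]],
        elim conjE, rule exI, rule conjI, assumption, intro allI impI conjI, goal_cases)
      case 1
      then show ?case using high by simp
    next
      case (2 \<epsilon>0 \<epsilon> N \<chi>int \<chi>mid \<chi>ext s \<kappa> s0)
      have "continuous_on UNIV \<chi>int" "fn_support \<chi>int \<subseteq> {\<xi>. norm \<xi> \<le> \<epsilon>}"
        using 2(6) by (simp_all add: frequency_partition_def smooth_cont)
      note C = 2(2)[rule_format, OF 2(4) this 2(8,9,10)]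
      show ?case
      proof (rule exE[OF C], elim conjE, rule exI, rule conjI, assumption, rule ballI, goal_cases)
        case w0: (1 C w0)
        show ?case by (rule w0(2)[THEN spec, THEN mp, THEN mp, OF data[OF w0(3)]])
      qed
    qed
  next
    case 3
    then show ?thesis by (intro exI[of _ 1]) auto
  qed
qed

end
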